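(* Let $q\ge 3$ be a prime power and let $V=GF(q)^5$. Let $qK_{5;\{2,4\}}$ be the graph whose vertices are the flags of type $\{2,4\}$ of $V$ (pairs $\{\alpha,\beta\}$ of subspaces with $\alpha\subset\beta$, $\dim\alpha=2$, $\dim\beta=4$), two flags $F,G$ being adjacent if and only if they are in general position, i.e.\ for all $\alpha\in F$ and $\beta\in G$ one has $\alpha\cap\beta=\{0\}$ or $\alpha+\beta=V$. Then the chromatic number of $qK_{5;\{2,4\}}$ is $\frac{q^4-1}{q-1}=q^3+q^2+q+1$. Moreover, in every coloring of $qK_{5;\{2,4\}}$ with $q^3+q^2+q+1$ colors, each color class is contained in a unique point-pencil, and the base points of the point-pencils so obtained are exactly the $1$-dimensional subspaces of a fixed $4$-dimensional subspace of $V$.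
   Context: For a $1$-dimensional subspace $T$ of $V$, the point-pencil with base point $T$ is the set of all flags $F$ of type $\{2,4\}$ such that $F\cup\{T\}$ is a flag, i.e.\ all flags $\{\alpha,\beta\}$ of type $\{2,4\}$ with $T\subseteq\alpha$. A flag of $V$ is a set of nontrivial subspaces (different from $\{0\}$ and $V$) that are pairwise comparable under inclusion; its type is the set of dimensions of its members. *)

theory Defs
  imports "HOL-Analysis.Analysis" "HOL-Library.Set_Algebras"
begin

section \<open>Vertex colorings\<close>

text \<open>A graph is given by its vertex set and its adjacency relation. A coloring with \<open>k\<close> colors
  takes its values in \<open>{..<k}\<close>; it is not required to use all of them.\<close>

definition proper_coloring :: "'v set \<Rightarrow> ('v \<Rightarrow> 'v \<Rightarrow> bool) \<Rightarrow> nat \<Rightarrow> ('v \<Rightarrow> nat) \<Rightarrow> bool" where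
  "proper_coloring V adj k c \<longleftrightarrow>
     c \<in> V \<rightarrow> {..<k} \<and> (\<forall>v\<in>V. \<forall>w\<in>V. adj v w \<longrightarrow> c v \<noteq> c w)"

definition chromatic_number :: "'v set \<Rightarrow> ('v \<Rightarrow> 'v \<Rightarrow> bool) \<Rightarrow> nat" where
  "chromatic_number V adj = (LEAST k. \<exists>c. proper_coloring V adj k c)"

definition color_class :: "'v set \<Rightarrow> ('v \<Rightarrow> nat) \<Rightarrow> nat \<Rightarrow> 'v set" where
  "color_class V c i = {v \<in> V. c v = i}"

section \<open>Flags of subspaces\<close>

definition flag :: "('a::field ^ 'n) set set \<Rightarrow> bool" where
  "flag F \<longleftrightarrow>
     (\<forall>U\<in>F. vec.subspace U \<and> U \<noteq> {0} \<and> U \<noteq> UNIV) \<and>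
     (\<forall>U\<in>F. \<forall>W\<in>F. U \<subseteq> W \<or> W \<subseteq> U)"

definition flag_type :: "('a::field ^ 'n) set set \<Rightarrow> nat set" where
  "flag_type F = vec.dim ` F"

definition flags_of_type :: "nat set \<Rightarrow> ('a::field ^ 'n) set set set" where
  "flags_of_type J = {F. flag F \<and> flag_type F = J}"

text \<open>The sum \<open>\<alpha> + \<beta>\<close> is the elementwise sum of sets, i.e. the sum of subspaces.\<close>

definition general_position ::
    "('a::field ^ 'n) set set \<Rightarrow> ('a ^ 'n) set set \<Rightarrow> bool" where
  "general_position F G \<longleftrightarrow> (\<forall>\<alpha>\<in>F. \<forall>\<beta>\<in>G. \<alpha> \<inter> \<beta> = {0} \<or> \<alpha> + \<beta> = UNIV)"

definition subspaces_of_dim :: "nat \<Rightarrow> ('a::field ^ 'n) set set" where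
  "subspaces_of_dim d = {U. vec.subspace U \<and> vec.dim U = d}"

definition point_pencil :: "('a::field ^ 'n) set \<Rightarrow> ('a ^ 'n) set set set" where
  "point_pencil T = {F \<in> flags_of_type {2, 4}. flag (F \<union> {T})}"

lemma general_position_sym: "general_position F G \<longleftrightarrow> general_position G F"
  unfolding general_position_def by (metis Int_commute add.commute)

lemma general_position_irrefl:
  assumes "F \<in> flags_of_type J" "J \<noteq> {}"
  shows "\<not> general_position F F"
proof
  assume gp: "general_position F F"
  from assms obtain U where U: "U \<in> F" "vec.subspace U" "U \<noteq> {0}" "U \<noteq> UNIV"
    by (auto simp: flags_of_type_def flag_type_def flag_def)
  have "U + U \<subseteq> U"
    using U(2) by (auto simp: set_plus_def vec.subspace_def)
  with gp U show False
    by (auto simp: general_position_def)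
qed

end

theory Submission
  imports Defs
begin

text \<open>
  Call one-, two-, three- and four-dimensional subspaces points, lines, planes and solids. Two flags
  \<open>(L, H)\<close>, \<open>(L', H')\<close> are adjacent iff \<open>L \<inter> L' = 0\<close>, \<open>L\<close> is not in \<open>H'\<close> and \<open>L'\<close> is not in \<open>H\<close>.

  A color class outside all point-pencils has at most \<open>(q\<^sup>2 + q + 1) (2 q\<^sup>2 + q + 1)\<close> flags. Indeed, call a
  line heavy if it carries two flags of the class. If \<open>L\<close> is heavy and \<open>(L', H')\<close> is in the class, then
  \<open>L\<close> meets \<open>L'\<close> or lies in \<open>H'\<close>. So the heavy lines meet pairwise and hence have a common point or a common
  plane, and two of them already restrict all other flags severely. If at most one line is heavy, fix a
  flag \<open>(L, H)\<close> on a line that is not heavy: every flag whose line \<open>L'\<close> misses \<open>L\<close> has \<open>L' \<subseteq> H\<close> or is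
  counted from the side of \<open>L'\<close>, which leaves few disjoint pairs, and at most one point of \<open>L\<close> is on many
  lines of the class.

  Let \<open>M\<close> be the set of base points of the classes contained in point-pencils and let
  \<open>x = q\<^sup>3 + q\<^sup>2 + q + 1 - |M|\<close>. All flags whose line misses \<open>M\<close> lie in at most \<open>x\<close> classes, so at most
  \<open>(2 q\<^sup>2 + q + 1) x\<close> lines miss \<open>M\<close>. On the other hand, at least \<open>x\<close> lines through each of the \<open>q\<^sup>4 + x\<close>
  points outside \<open>M\<close> miss \<open>M\<close>. This forces \<open>x = 0\<close> (with a refined count for \<open>q = 3\<close>), and then \<open>M\<close> is the set of points of a solid.
\<close>

section \<open>Subspaces over a finite field\<close>

lemma card_le_UN:
  assumes "finite I" and "\<And>i. i \<in> I \<Longrightarrow> finite (A i)" and "X \<subseteq> (\<Union>i\<in>I. A i)"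
    and "\<And>i. i \<in> I \<Longrightarrow> card (A i) \<le> k"
  shows "card X \<le> card I * k"
proof -
  have "card X \<le> card (\<Union>i\<in>I. A i)"
    using assms by (intro card_mono) auto
  also have "\<dots> \<le> (\<Sum>i\<in>I. card (A i))"
    using assms(1) by (rule card_UN_le)
  also have "\<dots> \<le> card I * k"
    using sum_bounded_above[of I "\<lambda>i. card (A i)" k] assms(4) by simp
  finally show ?thesis .
qed

lemma mult_add_1_cancel: "m * (k + 1) = n * (k + 1) \<Longrightarrow> m = (n :: nat)"
  by (simp only: mult_cancel2) simp

lemma subspaces_of_dimD:
  assumes "U \<in> subspaces_of_dim d"
  shows "vec.subspace U" "vec.dim U = d"
  using assms by (auto simp: subspaces_of_dim_def)

lemma subspaces_of_dimI: "vec.subspace U \<Longrightarrow> vec.dim U = d \<Longrightarrow> U \<in> subspaces_of_dim d"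
  by (simp add: subspaces_of_dim_def)

lemma zero_in_subspaces_of_dim: "{0} \<in> subspaces_of_dim 0"
  by (simp add: subspaces_of_dim_def vec.dim_eq_0)

lemma UNIV_in_subspaces_of_dim: "(UNIV :: ('a::field ^ 'n) set) \<in> subspaces_of_dim (CARD('n))"
  by (rule subspaces_of_dimI) (simp, rule vec_dim_card)

lemma subspaces_of_dim_eqI:
  assumes "U \<in> subspaces_of_dim d" "W \<in> subspaces_of_dim d" "U \<subseteq> W"
  shows "U = W"
  using assms vec.subspace_dim_equal[of U W] by (auto simp: subspaces_of_dim_def)

lemma subspaces_of_dim_mono:
  assumes "U \<in> subspaces_of_dim d" "W \<in> subspaces_of_dim e" "U \<subseteq> W"
  shows "d \<le> e"
  using assms vec.dim_subset[of U W] by (auto simp: subspaces_of_dim_def)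

text \<open>As a span, the join is a subspace for arbitrary arguments, which keeps
  \<open>subspace_join\<close> free of hypotheses. For subspaces it is their sum, by
  \<open>join_eq_sums\<close>, so the dimension formula applies.\<close>

definition join :: "('a::field ^ 'n) set \<Rightarrow> ('a ^ 'n) set \<Rightarrow> ('a ^ 'n) set" where
  "join U W = vec.span (U \<union> W)"

lemma subspace_join [simp]: "vec.subspace (join U W)"
  by (simp add: join_def)

lemma join_upper1: "U \<subseteq> join U W" and join_upper2: "W \<subseteq> join U W"
  using vec.span_superset[of "U \<union> W"] by (auto simp: join_def)

lemma join_least: "vec.subspace X \<Longrightarrow> U \<subseteq> X \<Longrightarrow> W \<subseteq> X \<Longrightarrow> join U W \<subseteq> X"
  unfolding join_def by (rule vec.span_minimal) auto

lemma join_eq_sums: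
  assumes "vec.subspace U" "vec.subspace W"
  shows "join U W = {x + y |x y. x \<in> U \<and> y \<in> W}"
  using assms by (simp add: join_def vec.span_Un vec.span_eq_iff[THEN iffD2])

lemma dim_join:
  assumes "vec.subspace U" "vec.subspace W"
  shows "vec.dim (join U W) + vec.dim (U \<inter> W) = vec.dim U + vec.dim W"
  using vec.dim_sums_Int[OF assms] by (simp add: join_eq_sums[OF assms])

lemma join_in_subspaces_of_dim:
  assumes "U \<in> subspaces_of_dim d" "W \<in> subspaces_of_dim e" "U \<inter> W \<in> subspaces_of_dim k"
    "f + k = d + e"
  shows "join U W \<in> subspaces_of_dim f"
  using assms dim_join[of U W] by (auto simp: subspaces_of_dim_def)

lemma Int_subspace_dim:
  assumes "U \<in> subspaces_of_dim d" "W \<in> subspaces_of_dim e"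
  obtains k where "U \<inter> W \<in> subspaces_of_dim k" "k \<le> d" "k \<le> e"
    "join U W \<in> subspaces_of_dim (d + e - k)"
proof -
  let ?k = "vec.dim (U \<inter> W)"
  have k: "U \<inter> W \<in> subspaces_of_dim ?k"
    using assms by (auto simp: subspaces_of_dim_def vec.subspace_inter)
  moreover have "?k \<le> d" "?k \<le> e"
    using subspaces_of_dim_mono[OF k assms(1)] subspaces_of_dim_mono[OF k assms(2)] by auto
  moreover from this have "join U W \<in> subspaces_of_dim (d + e - ?k)"
    using join_in_subspaces_of_dim[OF assms k] by simp
  ultimately show thesis using that by blast
qed

lemma subspace_dim_0_iff: "U \<in> subspaces_of_dim 0 \<longleftrightarrow> U = {0}"
  by (metis subspaces_of_dim_eqI subspaces_of_dimD vec.subspace_0 zero_in_subspaces_of_dim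
      empty_subsetI insert_subset)

lemma span_insert_in_subspaces_of_dim:
  assumes "U \<in> subspaces_of_dim d" "v \<notin> U"
  shows "vec.span (insert v U) \<in> subspaces_of_dim (Suc d)"
proof -
  have "vec.span U = U" using assms by (simp only: vec.span_eq_iff subspaces_of_dimD)
  with assms(2) have "v \<notin> vec.span U" by (simp only: not_False_eq_True)
  then show ?thesis using assms by (simp add: subspaces_of_dim_def vec.dim_insert)
qed

lemma extension_unique:
  assumes "U \<in> subspaces_of_dim d" "W \<in> subspaces_of_dim (Suc d)" "U \<subseteq> W" "v \<in> W" "v \<notin> U"
  shows "W = vec.span (insert v U)"
proof -
  have "vec.span (insert v U) \<subseteq> W"
    using assms by (intro vec.span_minimal) (auto simp: subspaces_of_dim_def)
  then show ?thesis
    using subspaces_of_dim_eqI[OF span_insert_in_subspaces_of_dim] assms by metis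
qed

lemma exists_between:
  assumes "U \<in> subspaces_of_dim d" "W \<in> subspaces_of_dim e" "U \<subseteq> W" "d < e"
  obtains X where "X \<in> subspaces_of_dim (Suc d)" "U \<subseteq> X" "X \<subseteq> W"
proof -
  have "U \<noteq> W" using assms by (auto simp: subspaces_of_dim_def)
  then obtain v where v: "v \<in> W" "v \<notin> U" using assms by blast
  have "vec.span (insert v U) \<subseteq> W"
    using assms v by (intro vec.span_minimal) (auto simp: subspaces_of_dim_def)
  then show thesis
    using that[OF span_insert_in_subspaces_of_dim[OF assms(1) v(2)]]
      vec.span_superset[of "insert v U"] by auto
qed

section \<open>Cardinalities and numbers of subspaces over a field with q elements\<close>

locale gf_space =
  fixes q :: nat and field_type :: "'a::{field,finite} itself"
  assumes q_def: "q = CARD('a)"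
begin

lemma q_ge_2: "2 \<le> q"
proof -
  have "card {0, 1 :: 'a} \<le> CARD('a)" by (rule card_mono) auto
  then show ?thesis by (simp add: q_def)
qed

text \<open>Each vector of the span is k v + u with a unique scalar k and a unique u in
  \<open>U\<close>: two representations with different scalars would put a nonzero multiple of v,
  and hence v, into \<open>U\<close>.\<close>

lemma card_span_insert:
  fixes v :: "'a ^ 'n"
  assumes "vec.subspace U" "v \<notin> U"
  shows "card (vec.span (insert v U)) = q * card U"
proof -
  have "inj_on (\<lambda>(k, u). k *s v + u) (UNIV \<times> U)"
  proof (rule inj_onI, clarify)
    fix k l u w assume *: "u \<in> U" "w \<in> U" and eq: "k *s v + u = l *s v + w"
    have "(k - l) *s v = w - u"
      using eq by (simp add: vec.scale_left_diff_distrib algebra_simps)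
    then have kl: "(k - l) *s v \<in> U"
      using * assms(1) by (metis vec.subspace_diff)
    have "k = l"
    proof (rule ccontr)
      assume "k \<noteq> l"
      then have "v = inverse (k - l) *s ((k - l) *s v)"
        by (metis vec.scale_scale vec.scale_one left_inverse right_minus_eq)
      then show False
        using kl assms by (metis vec.subspace_scale)
    qed
    with eq show "k = l \<and> u = w" by simp
  qed
  moreover have "vec.span (insert v U) = (\<lambda>(k, u). k *s v + u) ` (UNIV \<times> U)"
  proof (intro equalityI subsetI)
    have U: "vec.span U = U" using assms(1) by (simp only: vec.span_eq_iff)
    fix x
    {
      assume "x \<in> vec.span (insert v U)"
      then obtain k where "x - k *s v \<in> U"
        unfolding vec.span_insert U by blast
      then have "(k, x - k *s v) \<in> UNIV \<times> U" by simp
      then show "x \<in> (\<lambda>(k, u). k *s v + u) ` (UNIV \<times> U)"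
        by (rule rev_image_eqI) simp
    next
      assume "x \<in> (\<lambda>(k, u). k *s v + u) ` (UNIV \<times> U)"
      then obtain k u where "u \<in> U" "x = k *s v + u" by auto
      then show "x \<in> vec.span (insert v U)"
        unfolding vec.span_insert U by (auto intro!: exI[of _ k])
    }
  qed
  ultimately show ?thesis
    by (simp add: card_image card_cartesian_product q_def)
qed

text \<open>Induction over a hyperplane of \<open>U\<close>: omitting one basis vector leaves a
  subspace \<open>W\<close> of dimension d, and \<open>U\<close> is spanned by \<open>W\<close> and
  any further vector of \<open>U\<close>.\<close>

lemma card_subspace:
  fixes U :: "('a ^ 'n) set"
  assumes "U \<in> subspaces_of_dim d"
  shows "card U = q ^ d"
  using assms
proof (induction d arbitrary: U)
  case 0
  then show ?case by (simp add: subspace_dim_0_iff)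
next
  case (Suc d)
  have "\<exists>W \<in> subspaces_of_dim d. W \<subseteq> U"
  proof -
    obtain B where B: "B \<subseteq> U" "vec.independent B" "U \<subseteq> vec.span B" "card B = Suc d"
      using vec.basis_exists[of U] Suc.prems by (auto simp: subspaces_of_dim_def)
    then obtain b where b: "b \<in> B" by fastforce
    have "vec.independent (B - {b})"
      using B vec.independent_mono by blast
    moreover have "card (B - {b}) = d" using B b by simp
    ultimately have "vec.span (B - {b}) \<in> subspaces_of_dim d"
      using vec.dim_span_eq_card_independent by (intro subspaces_of_dimI) auto
    moreover have "vec.span (B - {b}) \<subseteq> U"
      using B Suc.prems by (intro vec.span_minimal) (auto simp: subspaces_of_dim_def)
    ultimately show ?thesis by blast
  qed
  then obtain W where W: "W \<in> subspaces_of_dim d" "W \<subseteq> U" by blast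
  moreover have "W \<noteq> U" using W Suc.prems by (auto simp: subspaces_of_dim_def)
  ultimately obtain v where v: "v \<in> U" "v \<notin> W" by blast
  show ?case
    using extension_unique[OF W(1) Suc.prems W(2) v]
      card_span_insert[OF subspaces_of_dimD(1)[OF W(1)] v(2)] Suc.IH[OF W(1)] by simp
qed

text \<open>The sets \<open>W - U\<close> partition \<open>X - U\<close>.\<close>
lemma card_extensions:
  fixes U :: "('a ^ 'n) set"
  assumes U: "U \<in> subspaces_of_dim d" and X: "X \<in> subspaces_of_dim (d + k)" and "U \<subseteq> X"
  shows "card {W \<in> subspaces_of_dim (Suc d). U \<subseteq> W \<and> W \<subseteq> X} = (\<Sum>i<k. q ^ i)"
proof -
  let ?E = "{W \<in> subspaces_of_dim (Suc d). U \<subseteq> W \<and> W \<subseteq> X}"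
  have "X - U = (\<Union>W\<in>?E. W - U)"
  proof (intro equalityI subsetI)
    fix v assume "v \<in> X - U"
    then have v: "v \<in> X" "v \<notin> U" by auto
    have "vec.span (insert v U) \<subseteq> X"
      using v assms by (intro vec.span_minimal) (auto simp: subspaces_of_dim_def)
    then have "vec.span (insert v U) \<in> ?E"
      using span_insert_in_subspaces_of_dim[OF U v(2)] vec.span_superset[of "insert v U"] by auto
    then show "v \<in> (\<Union>W\<in>?E. W - U)"
      using v vec.span_superset[of "insert v U"] by blast
  qed auto
  also have "card \<dots> = (\<Sum>W\<in>?E. card (W - U))"
  proof (rule card_UN_disjoint)
    show "\<forall>W\<in>?E. \<forall>W'\<in>?E. W \<noteq> W' \<longrightarrow> (W - U) \<inter> (W' - U) = {}"
    proof (intro ballI impI, rule ccontr)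
      fix W W' assume *: "W \<in> ?E" "W' \<in> ?E" and "W \<noteq> W'" and "(W - U) \<inter> (W' - U) \<noteq> {}"
      then obtain v where v: "v \<in> W" "v \<in> W'" "v \<notin> U" by blast
      have "W = vec.span (insert v U)"
        using * v by (intro extension_unique[OF U]) auto
      moreover have "W' = vec.span (insert v U)"
        using * v by (intro extension_unique[OF U]) auto
      ultimately have "W = W'" by simp
      with \<open>W \<noteq> W'\<close> show False by simp
    qed
  qed auto
  also have "\<dots> = (\<Sum>W\<in>?E. q ^ Suc d - q ^ d)"
  proof (rule sum.cong)
    fix W assume "W \<in> ?E"
    then have "card W = q ^ Suc d"
      by (intro card_subspace) simp
    moreover have "card (W - U) = card W - card U"
      using \<open>W \<in> ?E\<close> by (intro card_Diff_subset) auto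
    ultimately show "card (W - U) = q ^ Suc d - q ^ d"
      by (simp only: card_subspace[OF U])
  qed simp
  finally have eq: "q ^ (d + k) - q ^ d = card ?E * (q ^ Suc d - q ^ d)"
    using \<open>U \<subseteq> X\<close>
    by (simp only: card_Diff_subset[OF finite] card_subspace[OF U] card_subspace[OF X] sum_constant
        of_nat_id)
  \<comment> \<open>The two bounds turn truncated differences into integer differences, where q^d
    and then q - 1 can be cancelled.\<close>
  have le: "q ^ d \<le> q ^ (d + k)" "q ^ d \<le> q ^ Suc d"
    using q_ge_2 by (auto intro!: power_increasing)
  have "int (q ^ (d + k)) - int (q ^ d) = int (q ^ (d + k) - q ^ d)"
    by (simp only: of_nat_diff[OF le(1)])
  also have "\<dots> = int (card ?E) * (int (q ^ Suc d) - int (q ^ d))"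
    by (simp only: eq of_nat_mult of_nat_diff[OF le(2)])
  finally have "int q ^ d * (int q ^ k - 1) = int q ^ d * ((int q - 1) * int (card ?E))"
    by (simp add: algebra_simps power_add)
  then have "(int q - 1) * int (card ?E) = int q ^ k - 1"
    using q_ge_2 by simp
  also have "\<dots> = (int q - 1) * (\<Sum>i<k. int q ^ i)"
    by (rule power_diff_1_eq)
  finally have "int (card ?E) = (\<Sum>i<k. int q ^ i)"
    using q_ge_2 by simp
  also have "\<dots> = int (\<Sum>i<k. q ^ i)" by simp
  finally show ?thesis by linarith
qed

lemma sum_powers_numeral:
  "(\<Sum>i<2. q ^ i) = q + 1" "(\<Sum>i<3. q ^ i) = q ^ 2 + q + 1"
  "(\<Sum>i<4. q ^ i) = q ^ 3 + q ^ 2 + q + 1" "(\<Sum>i<5. q ^ i) = q ^ 4 + q ^ 3 + q ^ 2 + q + 1"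
  by (simp_all add: eval_nat_numeral lessThan_Suc)

lemma card_extensions_numeral:
  fixes U :: "('a ^ 'n) set"
  assumes "U \<in> subspaces_of_dim d" "U \<subseteq> X"
  shows "X \<in> subspaces_of_dim (d + 2) \<Longrightarrow>
      card {W \<in> subspaces_of_dim (Suc d). U \<subseteq> W \<and> W \<subseteq> X} = q + 1"
    and "X \<in> subspaces_of_dim (d + 3) \<Longrightarrow>
      card {W \<in> subspaces_of_dim (Suc d). U \<subseteq> W \<and> W \<subseteq> X} = q ^ 2 + q + 1"
    and "X \<in> subspaces_of_dim (d + 4) \<Longrightarrow>
      card {W \<in> subspaces_of_dim (Suc d). U \<subseteq> W \<and> W \<subseteq> X} = q ^ 3 + q ^ 2 + q + 1"
    and "X \<in> subspaces_of_dim (d + 5) \<Longrightarrow>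
      card {W \<in> subspaces_of_dim (Suc d). U \<subseteq> W \<and> W \<subseteq> X} = q ^ 4 + q ^ 3 + q ^ 2 + q + 1"
  using card_extensions[OF assms(1) _ assms(2)] by (simp_all only: sum_powers_numeral)

lemma card_points:
  fixes X :: "('a ^ 'n) set"
  assumes "X \<in> subspaces_of_dim k"
  shows "card {P \<in> subspaces_of_dim 1. P \<subseteq> X} = (\<Sum>i<k. q ^ i)"
proof -
  have "0 \<in> P" if "P \<in> subspaces_of_dim 1" for P :: "('a ^ 'n) set"
    using that by (simp add: subspaces_of_dim_def vec.subspace_0)
  then have "{P \<in> subspaces_of_dim 1. P \<subseteq> X} = {P \<in> subspaces_of_dim (Suc 0). {0} \<subseteq> P \<and> P \<subseteq> X}"
    by auto
  then show ?thesis
    using card_extensions[OF zero_in_subspaces_of_dim, where X = X and k = k] assms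
    by (simp add: subspaces_of_dim_def vec.subspace_0)
qed

lemma card_points_numeral:
  fixes X :: "('a ^ 'n) set"
  shows "X \<in> subspaces_of_dim 2 \<Longrightarrow> card {P \<in> subspaces_of_dim 1. P \<subseteq> X} = q + 1"
    and "X \<in> subspaces_of_dim 3 \<Longrightarrow> card {P \<in> subspaces_of_dim 1. P \<subseteq> X} = q ^ 2 + q + 1"
    and "X \<in> subspaces_of_dim 4 \<Longrightarrow> card {P \<in> subspaces_of_dim 1. P \<subseteq> X} = q ^ 3 + q ^ 2 + q + 1"
    and "X \<in> subspaces_of_dim 5 \<Longrightarrow>
      card {P \<in> subspaces_of_dim 1. P \<subseteq> X} = q ^ 4 + q ^ 3 + q ^ 2 + q + 1"
  by (simp_all add: card_points sum_powers_numeral del: One_nat_def)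

lemma card_lines_through:
  fixes X :: "('a ^ 'n) set"
  assumes "P \<in> subspaces_of_dim 1" "P \<subseteq> X"
  shows "X \<in> subspaces_of_dim 3 \<Longrightarrow> card {L \<in> subspaces_of_dim 2. P \<subseteq> L \<and> L \<subseteq> X} = q + 1"
    and "X \<in> subspaces_of_dim 4 \<Longrightarrow> card {L \<in> subspaces_of_dim 2. P \<subseteq> L \<and> L \<subseteq> X} = q ^ 2 + q + 1"
    and "X \<in> subspaces_of_dim 5 \<Longrightarrow>
      card {L \<in> subspaces_of_dim 2. P \<subseteq> L \<and> L \<subseteq> X} = q ^ 3 + q ^ 2 + q + 1"
  using card_extensions_numeral[OF assms] by (simp_all add: eval_nat_numeral)

text \<open>Double count of the incident point-line pairs in \<open>X\<close>. The factor q + 1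
  stays on the left to avoid a division of natural numbers.\<close>

lemma card_lines_in:
  fixes X :: "('a ^ 'n) set"
  assumes "X \<in> subspaces_of_dim (Suc n)"
  shows "card {L \<in> subspaces_of_dim 2. L \<subseteq> X} * (q + 1) = (\<Sum>i<Suc n. q ^ i) * (\<Sum>i<n. q ^ i)"
proof -
  let ?P = "{P \<in> subspaces_of_dim 1. P \<subseteq> X}" and ?L = "{L \<in> subspaces_of_dim 2. L \<subseteq> X}"
  have "(\<Sum>P\<in>?P. card {L \<in> ?L. P \<subseteq> L}) = (q + 1) * card ?L"
  proof (rule sum_multicount)
    show "\<forall>L\<in>?L. card {P \<in> ?P. P \<subseteq> L} = q + 1"
    proof
      fix L assume L: "L \<in> ?L"
      then have "{P \<in> ?P. P \<subseteq> L} = {P \<in> subspaces_of_dim 1. P \<subseteq> L}" by auto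
      then show "card {P \<in> ?P. P \<subseteq> L} = q + 1" using L card_points_numeral(1)[of L] by auto
    qed
  qed auto
  moreover have "card {L \<in> ?L. P \<subseteq> L} = (\<Sum>i<n. q ^ i)" if "P \<in> ?P" for P
  proof -
    have "{L \<in> ?L. P \<subseteq> L} = {L \<in> subspaces_of_dim (Suc 1). P \<subseteq> L \<and> L \<subseteq> X}"
      by (auto simp: numeral_2_eq_2)
    then show ?thesis using card_extensions[of P 1 X n] that assms by simp
  qed
  ultimately have "card ?P * (\<Sum>i<n. q ^ i) = (q + 1) * card ?L" by simp
  then show ?thesis using card_points[OF assms] by (simp add: mult.commute)
qed

lemma card_lines_in_plane:
  fixes X :: "('a ^ 'n) set"
  assumes "X \<in> subspaces_of_dim 3"
  shows "card {L \<in> subspaces_of_dim 2. L \<subseteq> X} = q ^ 2 + q + 1"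
proof -
  have "card {L \<in> subspaces_of_dim 2. L \<subseteq> X} * (q + 1) = (q ^ 2 + q + 1) * (q + 1)"
    using card_lines_in[of X 2] assms by (simp add: sum_powers_numeral)
  then show ?thesis by (rule mult_add_1_cancel)
qed

lemma card_lines_in_solid:
  fixes X :: "('a ^ 'n) set"
  assumes "X \<in> subspaces_of_dim 4"
  shows "card {L \<in> subspaces_of_dim 2. L \<subseteq> X} = (q ^ 2 + 1) * (q ^ 2 + q + 1)"
proof -
  have "card {L \<in> subspaces_of_dim 2. L \<subseteq> X} * (q + 1) = (q ^ 2 + 1) * (q ^ 2 + q + 1) * (q + 1)"
    using card_lines_in[of X 3] assms
    by (simp add: sum_powers_numeral algebra_simps power2_eq_square power3_eq_cube)
  then show ?thesis by (rule mult_add_1_cancel)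
qed

text \<open>Double count of the pairs of a plane and a solid through \<open>L\<close>, one inside
  the other. Each solid contains q + 1 such planes and each plane lies in q + 1 such solids, so
  there are as many solids as planes through \<open>L\<close>.\<close>

lemma card_solids_through_line:
  fixes L :: "('a ^ 'n) set"
  assumes L: "L \<in> subspaces_of_dim 2" and X: "X \<in> subspaces_of_dim 5" and LX: "L \<subseteq> X"
  shows "card {H \<in> subspaces_of_dim 4. L \<subseteq> H \<and> H \<subseteq> X} = q ^ 2 + q + 1"
proof -
  let ?E = "{E \<in> subspaces_of_dim 3. L \<subseteq> E \<and> E \<subseteq> X}"
  let ?H = "{H \<in> subspaces_of_dim 4. L \<subseteq> H \<and> H \<subseteq> X}"
  have "card {E \<in> ?E. E \<subseteq> H} = q + 1" if H: "H \<in> ?H" for H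
  proof -
    have "{E \<in> ?E. E \<subseteq> H} = {E \<in> subspaces_of_dim (Suc 2). L \<subseteq> E \<and> E \<subseteq> H}"
      using H by (simp add: set_eq_iff) blast
    then show ?thesis
      using H card_extensions_numeral(1)[OF L, of H] by simp
  qed
  then have "(\<Sum>E\<in>?E. card {H \<in> ?H. E \<subseteq> H}) = (q + 1) * card ?H"
    by (intro sum_multicount) auto
  moreover have "card {H \<in> ?H. E \<subseteq> H} = q + 1" if E: "E \<in> ?E" for E
  proof -
    have "{H \<in> ?H. E \<subseteq> H} = {H \<in> subspaces_of_dim (Suc 3). E \<subseteq> H \<and> H \<subseteq> X}"
      using E by (simp add: set_eq_iff) blast
    then show ?thesis using card_extensions_numeral(1)[of E 3 X] E X by simp
  qed
  moreover have "card ?E = q ^ 2 + q + 1"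
    using card_extensions_numeral(2)[OF L LX] X by simp
  ultimately have "card ?H * (q + 1) = (q ^ 2 + q + 1) * (q + 1)"
    by (simp only: sum_constant mult.commute of_nat_id sum.cong)
  then show ?thesis by (rule mult_add_1_cancel)
qed

end

section \<open>Incidence in a five-dimensional space\<close>

abbreviation "points \<equiv> subspaces_of_dim 1"
abbreviation "lines \<equiv> subspaces_of_dim 2"
abbreviation "planes \<equiv> subspaces_of_dim 3"
abbreviation "solids \<equiv> subspaces_of_dim 4"

lemma point_in_Int:
  assumes "vec.subspace U" "vec.subspace W" "U \<inter> W \<noteq> {0}"
  obtains P where "P \<in> points" "P \<subseteq> U" "P \<subseteq> W"
proof -
  obtain v where v: "v \<in> U" "v \<in> W" "v \<noteq> 0"
    using assms vec.subspace_0 by blast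
  have "vec.span {v} \<in> points"
    using v by (intro subspaces_of_dimI) (simp_all add: vec.dim_singleton)
  moreover have "vec.span {v} \<subseteq> U" "vec.span {v} \<subseteq> W"
    using v assms(1,2) by (simp_all add: vec.span_minimal)
  ultimately show thesis using that by blast
qed

lemma common_point:
  assumes "U \<in> subspaces_of_dim d" "W \<in> subspaces_of_dim e" "U \<inter> W \<noteq> {0}"
  obtains P where "P \<in> points" "P \<subseteq> U" "P \<subseteq> W"
  by (rule point_in_Int[OF subspaces_of_dimD(1)[OF assms(1)] subspaces_of_dimD(1)[OF assms(2)] assms(3)])

lemma not_subset_zero:
  assumes "P \<in> subspaces_of_dim d" "0 < d"
  shows "\<not> P \<subseteq> {0}"
  using assms subspaces_of_dim_mono[OF assms(1) zero_in_subspaces_of_dim] by auto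

lemma Int_nonzero:
  assumes "P \<in> points" "P \<subseteq> U" "P \<subseteq> W"
  shows "U \<inter> W \<noteq> {0}"
  using not_subset_zero[OF assms(1)] assms(2,3) by auto

lemma point_Int:
  assumes "P \<in> points" "vec.subspace U" "\<not> P \<subseteq> U"
  shows "P \<inter> U = {0}"
proof (rule ccontr)
  assume "P \<inter> U \<noteq> {0}"
  then obtain R where R: "R \<in> points" "R \<subseteq> P" "R \<subseteq> U"
    by (rule point_in_Int[OF subspaces_of_dimD(1)[OF assms(1)] assms(2)])
  then have "R = P" using assms(1) subspaces_of_dim_eqI by blast
  with R assms show False by simp
qed

lemma points_subset_eq: "P \<in> points \<Longrightarrow> Q \<in> points \<Longrightarrow> P \<subseteq> Q \<Longrightarrow> P = Q"
  by (rule subspaces_of_dim_eqI)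

lemma join_point:
  assumes "P \<in> points" "U \<in> subspaces_of_dim d" "\<not> P \<subseteq> U"
  shows "join P U \<in> subspaces_of_dim (Suc d)"
proof (rule join_in_subspaces_of_dim[OF assms(1,2)])
  have "P \<inter> U = {0}"
    using point_Int[OF assms(1) subspaces_of_dimD(1)[OF assms(2)] assms(3)] .
  then show "P \<inter> U \<in> subspaces_of_dim 0"
    using zero_in_subspaces_of_dim by simp
qed simp

lemma join_points:
  assumes "P \<in> points" "Q \<in> points" "P \<noteq> Q"
  shows "join P Q \<in> lines"
proof -
  have "\<not> P \<subseteq> Q" using points_subset_eq[OF assms(1,2)] assms(3) by blast
  then have "join P Q \<in> subspaces_of_dim (Suc 1)" by (rule join_point[OF assms(1,2)])
  then show ?thesis by (simp only: Suc_1)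
qed

lemma join_point_line:
  assumes "P \<in> points" "L \<in> lines" "\<not> P \<subseteq> L"
  shows "join P L \<in> planes"
  using join_point[OF assms] by (simp add: eval_nat_numeral)

lemma join_point_plane:
  assumes "P \<in> points" "E \<in> planes" "\<not> P \<subseteq> E"
  shows "join P E \<in> solids"
  using join_point[OF assms] by (simp add: eval_nat_numeral)

lemma line_eq_join:
  assumes "P \<in> points" "Q \<in> points" "P \<noteq> Q" "L \<in> lines" "P \<subseteq> L" "Q \<subseteq> L"
  shows "L = join P Q"
  using subspaces_of_dim_eqI[OF join_points[OF assms(1-3)] assms(4)]
    join_least[OF subspaces_of_dimD(1)[OF assms(4)] assms(5,6)] by simp

lemma line_subset:
  assumes "P \<in> points" "Q \<in> points" "P \<noteq> Q" "L \<in> lines" "P \<subseteq> L" "Q \<subseteq> L"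
    "vec.subspace U" "P \<subseteq> U" "Q \<subseteq> U"
  shows "L \<subseteq> U"
  using line_eq_join[OF assms(1-6)] join_least[OF assms(7-9)] by simp

lemma lines_eqI:
  assumes "P \<in> points" "Q \<in> points" "P \<noteq> Q" "L \<in> lines" "P \<subseteq> L" "Q \<subseteq> L"
    "M \<in> lines" "P \<subseteq> M" "Q \<subseteq> M"
  shows "L = M"
  using line_eq_join[OF assms(1-6)] line_eq_join[OF assms(1-3,7-9)] by simp

lemma meeting_point:
  assumes "L \<in> lines" "M \<in> lines" "L \<noteq> M" "L \<inter> M \<noteq> {0}"
  obtains P where "P \<in> points" "P \<subseteq> L" "P \<subseteq> M" "join L M \<in> planes"
    "\<forall>Q\<in>points. Q \<subseteq> L \<longrightarrow> Q \<subseteq> M \<longrightarrow> Q = P"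
proof -
  obtain P where P: "P \<in> points" "P \<subseteq> L" "P \<subseteq> M"
    using point_in_Int[OF subspaces_of_dimD(1) subspaces_of_dimD(1), OF assms(1,2,4)] .
  have uniq: "Q = P" if "Q \<in> points" "Q \<subseteq> L" "Q \<subseteq> M" for Q
  proof (rule ccontr)
    assume "Q \<noteq> P"
    from lines_eqI[OF that(1) P(1) this assms(1) that(2) P(2) assms(2) that(3) P(3)] assms(3)
    show False by simp
  qed
  obtain k where k: "L \<inter> M \<in> subspaces_of_dim k" "k \<le> 2" "join L M \<in> subspaces_of_dim (2 + 2 - k)"
    using Int_subspace_dim[OF assms(1,2)] by metis
  have "k \<noteq> 0" using k assms(4) by (metis subspace_dim_0_iff)
  moreover have "k \<noteq> 2"
  proof
    assume "k = 2"
    then have "L \<inter> M \<in> lines" using k(1) by simp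
    from subspaces_of_dim_eqI[OF this assms(1)] subspaces_of_dim_eqI[OF this assms(2)]
    have "L \<inter> M = L" "L \<inter> M = M" by auto
    with assms(3) show False by simp
  qed
  ultimately have "k = 1" using k(2) by linarith
  with k(3) have "join L M \<in> planes" by simp
  moreover have "\<forall>Q\<in>points. Q \<subseteq> L \<longrightarrow> Q \<subseteq> M \<longrightarrow> Q = P"
    by (intro ballI impI) (rule uniq)
  ultimately show thesis by (rule that[OF P])
qed

text \<open>Otherwise the join would have dimension d + e inside the n-dimensional
  \<open>X\<close>.\<close>

lemma Int_nonzero_if_dim:
  assumes "U \<in> subspaces_of_dim d" "W \<in> subspaces_of_dim e" "X \<in> subspaces_of_dim n"
    "U \<subseteq> X" "W \<subseteq> X" "n < d + e"
  shows "U \<inter> W \<noteq> {0}"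
proof
  assume "U \<inter> W = {0}"
  then have J: "join U W \<in> subspaces_of_dim (d + e)"
    using zero_in_subspaces_of_dim by (intro join_in_subspaces_of_dim[OF assms(1,2), of 0]) simp_all
  moreover have "join U W \<subseteq> X"
    using assms(4,5) by (intro join_least subspaces_of_dimD(1)[OF assms(3)])
  ultimately show False using subspaces_of_dim_mono[OF J assms(3)] assms(6) by simp
qed

lemma join_disjoint_lines:
  assumes "L \<in> lines" "M \<in> lines" "L \<inter> M = {0}"
  shows "join L M \<in> solids"
  using assms(3) zero_in_subspaces_of_dim by (intro join_in_subspaces_of_dim[OF assms(1,2), of 0]) simp_all

lemma UNIV_dim_5: "(UNIV :: ('a::field ^ 5) set) \<in> subspaces_of_dim 5"
  using UNIV_in_subspaces_of_dim[where 'n = 5] by simp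

lemma line_meets_solid:
  fixes L :: "('a::field ^ 5) set"
  assumes "L \<in> lines" "H \<in> solids"
  shows "L \<inter> H \<noteq> {0}"
  using Int_nonzero_if_dim[OF assms UNIV_dim_5] by simp

lemma solids_Int:
  fixes H :: "('a::field ^ 5) set"
  assumes "H \<in> solids" "H' \<in> solids" "H \<noteq> H'"
  shows "H \<inter> H' \<in> planes"
proof -
  obtain k where k: "H \<inter> H' \<in> subspaces_of_dim k" "k \<le> 4" "join H H' \<in> subspaces_of_dim (4 + 4 - k)"
    using Int_subspace_dim[OF assms(1,2)] by metis
  have "k \<noteq> 4"
  proof
    assume "k = 4"
    then have "H \<inter> H' \<in> solids" using k(1) by simp
    from subspaces_of_dim_eqI[OF this assms(1)] subspaces_of_dim_eqI[OF this assms(2)]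
    have "H \<inter> H' = H" "H \<inter> H' = H'" by auto
    with assms(3) show False by simp
  qed
  moreover have "4 + 4 - k \<le> 5"
    using subspaces_of_dim_mono[OF k(3) UNIV_dim_5] by simp
  ultimately have "k = 3" using k(2) by linarith
  with k show ?thesis by simp
qed

section \<open>Numbers of lines in a solid\<close>

context gf_space
begin

lemma card_lines_in_solid_not_through_point:
  fixes H :: "('a ^ 'n) set"
  assumes "H \<in> solids" "P \<in> points" "P \<subseteq> H"
  shows "card {L \<in> lines. L \<subseteq> H \<and> \<not> P \<subseteq> L} = q ^ 2 * (q ^ 2 + q + 1)"
proof -
  have "{L \<in> lines. L \<subseteq> H \<and> \<not> P \<subseteq> L} = {L \<in> lines. L \<subseteq> H} - {L \<in> lines. P \<subseteq> L \<and> L \<subseteq> H}"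
    by blast
  moreover have "card ({L \<in> lines. L \<subseteq> H} - {L \<in> lines. P \<subseteq> L \<and> L \<subseteq> H})
      = (q ^ 2 + 1) * (q ^ 2 + q + 1) - (q ^ 2 + q + 1)"
    using card_lines_in_solid[OF assms(1)] card_lines_through(2)[OF assms(2,3,1)]
    by (subst card_Diff_subset) auto
  ultimately show ?thesis by (simp add: algebra_simps)
qed

lemma card_lines_in_solid_not_in_plane:
  fixes H :: "('a ^ 'n) set"
  assumes "H \<in> solids" "E \<in> planes" "E \<subseteq> H"
  shows "card {L \<in> lines. L \<subseteq> H \<and> \<not> L \<subseteq> E} = q ^ 2 * (q ^ 2 + q + 1)"
proof -
  have "{L \<in> lines. L \<subseteq> H \<and> \<not> L \<subseteq> E} = {L \<in> lines. L \<subseteq> H} - {L \<in> lines. L \<subseteq> E}"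
    by blast
  moreover have "card ({L \<in> lines. L \<subseteq> H} - {L \<in> lines. L \<subseteq> E})
      = (q ^ 2 + 1) * (q ^ 2 + q + 1) - (q ^ 2 + q + 1)"
    using card_lines_in_solid[OF assms(1)] card_lines_in_plane[OF assms(2)] assms(3)
    by (subst card_Diff_subset) auto
  ultimately show ?thesis by (simp add: algebra_simps)
qed

lemma card_lines_through_point_not_in_plane:
  fixes H :: "('a ^ 'n) set"
  assumes "H \<in> solids" "E \<in> planes" "E \<subseteq> H" "P \<in> points" "P \<subseteq> E"
  shows "card {L \<in> lines. P \<subseteq> L \<and> L \<subseteq> H \<and> \<not> L \<subseteq> E} = q ^ 2"
proof -
  have "{L \<in> lines. P \<subseteq> L \<and> L \<subseteq> H \<and> \<not> L \<subseteq> E}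
      = {L \<in> lines. P \<subseteq> L \<and> L \<subseteq> H} - {L \<in> lines. P \<subseteq> L \<and> L \<subseteq> E}"
    by blast
  moreover have "card ({L \<in> lines. P \<subseteq> L \<and> L \<subseteq> H} - {L \<in> lines. P \<subseteq> L \<and> L \<subseteq> E})
      = (q ^ 2 + q + 1) - (q + 1)"
    using card_lines_through(2)[OF assms(4) _ assms(1)] card_lines_through(1)[OF assms(4,5,2)] assms(3,5)
    by (subst card_Diff_subset) auto
  ultimately show ?thesis by simp
qed

text \<open>Fix a plane \<open>E\<close> with L \<le> E \<le> H. A line of \<open>H\<close> disjoint
  from \<open>L\<close> is not in \<open>E\<close> and meets \<open>E\<close> in one of the q^2
  points off \<open>L\<close>; through each such point there are q^2 lines of \<open>H\<close>
  outside \<open>E\<close>.\<close>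

lemma card_lines_in_solid_disjoint:
  fixes H :: "('a ^ 'n) set"
  assumes H: "H \<in> solids" and L: "L \<in> lines" and LH: "L \<subseteq> H"
  shows "card {M \<in> lines. M \<subseteq> H \<and> M \<inter> L = {0}} \<le> q ^ 4"
proof -
  obtain E where E: "E \<in> planes" "L \<subseteq> E" "E \<subseteq> H"
    using exists_between[OF L H LH] by auto
  let ?R = "{R \<in> points. R \<subseteq> E \<and> \<not> R \<subseteq> L}"
  have "?R = {R \<in> points. R \<subseteq> E} - {R \<in> points. R \<subseteq> L}"
    by blast
  moreover have "card ({R \<in> points. R \<subseteq> E} - {R \<in> points. R \<subseteq> L}) = (q ^ 2 + q + 1) - (q + 1)"
    using card_points_numeral(2)[OF E(1)] card_points_numeral(1)[OF L] E(2)
    by (subst card_Diff_subset) auto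
  ultimately have "card ?R = q ^ 2" by simp
  moreover have "card {M \<in> lines. M \<subseteq> H \<and> M \<inter> L = {0}} \<le> card ?R * q ^ 2"
  proof (rule card_le_UN)
    show "{M \<in> lines. M \<subseteq> H \<and> M \<inter> L = {0}}
        \<subseteq> (\<Union>R\<in>?R. {M \<in> lines. R \<subseteq> M \<and> M \<subseteq> H \<and> \<not> M \<subseteq> E})"
    proof
      fix M assume M: "M \<in> {M \<in> lines. M \<subseteq> H \<and> M \<inter> L = {0}}"
      then have "M \<inter> E \<noteq> {0}"
        using Int_nonzero_if_dim[of M 2 E 3 H 4] E H by simp
      then obtain R where R: "R \<in> points" "R \<subseteq> M" "R \<subseteq> E"
        using M by (elim point_in_Int[OF _ subspaces_of_dimD(1)[OF E(1)], rotated])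
          (auto simp: subspaces_of_dimD)
      have "\<not> R \<subseteq> L" using R M Int_nonzero[of R M L] by auto
      moreover have "\<not> M \<subseteq> E"
        using Int_nonzero_if_dim[of M 2 L 2 E 3] M L E by auto
      ultimately show "M \<in> (\<Union>R\<in>?R. {M \<in> lines. R \<subseteq> M \<and> M \<subseteq> H \<and> \<not> M \<subseteq> E})"
        using R M by blast
    qed
    show "card {M \<in> lines. R \<subseteq> M \<and> M \<subseteq> H \<and> \<not> M \<subseteq> E} \<le> q ^ 2" if "R \<in> ?R" for R
      using card_lines_through_point_not_in_plane[OF H E(1,3)] that by simp
  qed auto
  ultimately show ?thesis by (simp flip: power_add)
qed

end

section \<open>Flags of lines and solids\<close>

text \<open>Ordered pairs make the line and the solid available as \<open>fst\<close> and
  \<open>snd\<close>. By \<open>flag_iff_line_solid\<close> they correspond to the flags of type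
  \<open>{2, 4}\<close>.\<close>

definition line_solid_flags :: "(('a::field ^ 5) set \<times> ('a ^ 5) set) set" where
  "line_solid_flags = {(L, H). L \<in> lines \<and> H \<in> solids \<and> L \<subseteq> H}"

lemma line_solid_flagsD:
  assumes "f \<in> line_solid_flags"
  shows "fst f \<in> lines" "snd f \<in> solids" "fst f \<subseteq> snd f"
  using assms by (auto simp: line_solid_flags_def)

text \<open>No two flags of a coclique are in general position; the conditions of general position not
  listed here hold for dimension reasons or follow from the others.\<close>
definition coclique :: "(('a::field ^ 5) set \<times> ('a ^ 5) set) set \<Rightarrow> bool" where
  "coclique F \<longleftrightarrow> F \<subseteq> line_solid_flags \<and>
     (\<forall>f\<in>F. \<forall>g\<in>F. fst f \<inter> fst g \<noteq> {0} \<or> fst f \<subseteq> snd g \<or> fst g \<subseteq> snd f)"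

lemma cocliqueD:
  assumes "coclique F" "f \<in> F" "g \<in> F" "fst f \<inter> fst g = {0}"
  shows "fst f \<subseteq> snd g \<or> fst g \<subseteq> snd f"
  using assms unfolding coclique_def by blast

lemma coclique_flag:
  assumes "coclique F" "f \<in> F"
  shows "f \<in> line_solid_flags" "fst f \<in> lines" "snd f \<in> solids" "fst f \<subseteq> snd f"
proof -
  show "f \<in> line_solid_flags" using assms unfolding coclique_def by blast
  then show "fst f \<in> lines" "snd f \<in> solids" "fst f \<subseteq> snd f" by (rule line_solid_flagsD)+
qed

lemma coclique_subset: "coclique F \<Longrightarrow> G \<subseteq> F \<Longrightarrow> coclique G"
  unfolding coclique_def by (meson subset_iff)

definition heavy :: "('b \<times> 'c) set \<Rightarrow> 'b \<Rightarrow> bool" where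
  "heavy F L \<longleftrightarrow> (\<exists>H H'. H \<noteq> H' \<and> (L, H) \<in> F \<and> (L, H') \<in> F)"

lemma inj_on_fst_light: "inj_on fst {f \<in> F. \<not> heavy F (fst f)}"
proof (rule inj_onI)
  fix f g assume "f \<in> {f \<in> F. \<not> heavy F (fst f)}" "g \<in> {f \<in> F. \<not> heavy F (fst f)}" "fst f = fst g"
  then show "f = g" unfolding heavy_def by (cases f; cases g) auto
qed

text \<open>If \<open>L\<close> were not in the solid of \<open>f\<close>, the coclique condition
  would put the line of \<open>f\<close> into every solid paired with \<open>L\<close>. Each such
  solid would then be the join of the two lines, but a heavy line has two different solids.\<close>

lemma heavy_subset_solid:
  fixes F :: "(('a::field ^ 5) set \<times> ('a ^ 5) set) set"
  assumes F: "coclique F" and "heavy F L" and f: "f \<in> F" and disj: "L \<inter> fst f = {0}"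
  shows "L \<subseteq> snd f"
proof (rule ccontr)
  assume L: "\<not> L \<subseteq> snd f"
  obtain H H' where H: "H \<noteq> H'" "(L, H) \<in> F" "(L, H') \<in> F"
    using assms(2) unfolding heavy_def by blast
  have eq: "K = join L (fst f)" if "(L, K) \<in> F" for K
  proof -
    have "fst f \<subseteq> K"
      using cocliqueD[OF F that f] L disj by simp
    moreover have "L \<in> lines" "K \<in> solids" "L \<subseteq> K"
      using coclique_flag[OF F that] by simp_all
    moreover have "join L (fst f) \<in> solids"
      using join_disjoint_lines coclique_flag(2)[OF F] f \<open>L \<in> lines\<close> disj by blast
    ultimately show ?thesis
      using subspaces_of_dim_eqI join_least subspaces_of_dimD(1) by metis
  qed
  show False using eq[OF H(2)] eq[OF H(3)] H(1) by simp
qed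

lemma heavy_line:
  assumes "coclique F" "heavy F L"
  shows "L \<in> lines"
  using assms coclique_flag(2)[OF assms(1)] unfolding heavy_def by (metis fst_conv)

text \<open>If the lines were disjoint, \<open>heavy_subset_solid\<close> would put \<open>L\<close>
  into every solid paired with \<open>M\<close>, so each of them would be the join of
  \<open>L\<close> and \<open>M\<close>, although there are two.\<close>

lemma heavy_lines_meet:
  fixes F :: "(('a::field ^ 5) set \<times> ('a ^ 5) set) set"
  assumes F: "coclique F" and L: "heavy F L" and M: "heavy F M"
  shows "L \<inter> M \<noteq> {0}"
proof
  assume disj: "L \<inter> M = {0}"
  obtain H H' where H: "H \<noteq> H'" "(M, H) \<in> F" "(M, H') \<in> F"
    using M unfolding heavy_def by blast
  have J: "join L M \<in> solids"
    by (rule join_disjoint_lines[OF heavy_line[OF F L] heavy_line[OF F M] disj])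
  have eq: "join L M = K" if "(M, K) \<in> F" for K
  proof (rule subspaces_of_dim_eqI[OF J])
    show K: "K \<in> solids" using coclique_flag(3)[OF F that] by simp
    have "L \<subseteq> K" using heavy_subset_solid[OF F L that] disj by simp
    moreover have "M \<subseteq> K" using coclique_flag(4)[OF F that] by simp
    ultimately show "join L M \<subseteq> K" using join_least subspaces_of_dimD(1)[OF K] by blast
  qed
  show False using eq[OF H(2)] eq[OF H(3)] H(1) by simp
qed

section \<open>Numbers of lines, solids and flags in dimension five\<close>

context gf_space
begin

lemma card_solids_through_line_5:
  fixes L :: "('a ^ 5) set"
  assumes "L \<in> lines"
  shows "card {H \<in> solids. L \<subseteq> H} = q ^ 2 + q + 1"
  using card_solids_through_line[OF assms UNIV_dim_5] by simp

lemma card_lines_through_5: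
  fixes P :: "('a ^ 5) set"
  assumes "P \<in> points"
  shows "card {L \<in> lines. P \<subseteq> L} = q ^ 3 + q ^ 2 + q + 1"
  using card_lines_through(3)[OF assms _ UNIV_dim_5] by simp

lemma card_flags_le:
  fixes X :: "(('a ^ 5) set \<times> ('a ^ 5) set) set"
  assumes "X \<subseteq> line_solid_flags" "fst ` X \<subseteq> A" "A \<subseteq> lines"
  shows "card X \<le> card A * (q ^ 2 + q + 1)"
proof (rule card_le_UN)
  show "X \<subseteq> (\<Union>L\<in>A. Pair L ` {H \<in> solids. L \<subseteq> H})"
  proof
    fix f assume f: "f \<in> X"
    then have "f \<in> line_solid_flags" "fst f \<in> A" using assms by auto
    moreover from this have "f = Pair (fst f) (snd f)" "snd f \<in> {H \<in> solids. fst f \<subseteq> H}"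
      using line_solid_flagsD[of f] by simp_all
    ultimately show "f \<in> (\<Union>L\<in>A. Pair L ` {H \<in> solids. L \<subseteq> H})" by blast
  qed
  show "card (Pair L ` {H \<in> solids. L \<subseteq> H}) \<le> q ^ 2 + q + 1" if "L \<in> A" for L
  proof -
    have "L \<in> lines" using that assms(3) by blast
    from card_solids_through_line_5[OF this] card_image_le[of "{H \<in> solids. L \<subseteq> H}" "Pair L"]
    show ?thesis by simp
  qed
qed auto

lemma card_le_inj_fst:
  fixes X :: "(('a ^ 5) set \<times> ('a ^ 5) set) set"
  assumes "inj_on fst X" "fst ` X \<subseteq> A"
  shows "card X \<le> card A"
  using card_image[OF assms(1)] card_mono[OF _ assms(2)] by simp

end

section \<open>Cocliques with one solid per line\<close>

locale light_coclique = gf_space q field_type for q and field_type :: "'a::{field,finite} itself" +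
  fixes G :: "(('a ^ 5) set \<times> ('a ^ 5) set) set"
  assumes coclique: "coclique G" and inj: "inj_on fst G"
begin

text \<open>The lines counted pass through \<open>Q\<close> and lie in a plane or solid
  \<open>X\<close> that also contains \<open>K\<close>. At most q^2 + q + 1 lines of
  \<open>X\<close> pass through \<open>Q\<close>, and \<open>K\<close> is one of them that is
  excluded.\<close>

lemma card_meeting_or_in_solid:
  assumes f: "f \<in> G" and P: "P \<in> points" "P \<subseteq> fst f" and Q: "Q \<in> points" "Q \<noteq> P"
    and K: "K \<in> lines" "P \<subseteq> K" "Q \<subseteq> K" and fK: "fst f \<noteq> K"
  shows "card {g \<in> G. Q \<subseteq> fst g \<and> fst g \<noteq> K \<and> (fst f \<inter> fst g \<noteq> {0} \<or> fst g \<subseteq> snd f)} \<le> q ^ 2 + q"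
    (is "card ?B \<le> _")
proof -
  note Gf = coclique_flag[OF coclique f]
  have Qf: "\<not> Q \<subseteq> fst f"
    using lines_eqI[OF P(1) Q(1) Q(2)[symmetric] Gf(2) P(2) _ K] fK by blast
  then have J: "join Q (fst f) \<in> planes"
    by (rule join_point_line[OF Q(1) Gf(2)])
  \<comment> \<open>If \<open>Q\<close> lies in the solid of \<open>f\<close>, a line through
    \<open>Q\<close> that meets \<open>fst f\<close> lies in this solid as well. If not, no line
    through \<open>Q\<close> lies in the solid, so only the lines meeting \<open>fst f\<close>
    remain, and these lie in the plane spanned by \<open>Q\<close> and \<open>fst f\<close>.\<close>
  define X where "X = (if Q \<subseteq> snd f then snd f else join Q (fst f))"
  have X: "vec.subspace X" using Gf(3) by (simp add: X_def subspaces_of_dimD)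
  have QX: "Q \<subseteq> X" and fX: "fst f \<subseteq> X"
    using Gf(4) by (simp_all add: X_def join_upper1 join_upper2)
  have KX: "K \<subseteq> X"
    by (rule line_subset[OF P(1) Q(1) Q(2)[symmetric] K X subset_trans[OF P(2) fX] QX])
  have sub: "fst ` ?B \<subseteq> {L \<in> lines. Q \<subseteq> L \<and> L \<subseteq> X} - {K}"
  proof
    fix L assume "L \<in> fst ` ?B"
    then obtain g where g: "g \<in> G" "L = fst g" "Q \<subseteq> L" "L \<noteq> K" "fst f \<inter> L \<noteq> {0} \<or> L \<subseteq> snd f"
      by auto
    have L: "L \<in> lines" using coclique_flag(2)[OF coclique g(1)] g(2) by simp
    have "L \<subseteq> X"
    proof (cases "L \<subseteq> snd f")
      case True
      moreover from subset_trans[OF g(3) True] have "X = snd f" by (simp add: X_def)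
      ultimately show ?thesis by simp
    next
      case False
      with g(5) have "fst f \<inter> L \<noteq> {0}" by simp
      then obtain R where R: "R \<in> points" "R \<subseteq> fst f" "R \<subseteq> L"
        by (rule common_point[OF Gf(2) L])
      have "R \<noteq> Q" using R Qf by blast
      then show ?thesis
        by (rule line_subset[OF R(1) Q(1) _ L R(3) g(3) X subset_trans[OF R(2) fX] QX])
    qed
    with g L show "L \<in> {L \<in> lines. Q \<subseteq> L \<and> L \<subseteq> X} - {K}" by simp
  qed
  have "card {L \<in> lines. Q \<subseteq> L \<and> L \<subseteq> X} \<le> q ^ 2 + q + 1"
  proof (cases "Q \<subseteq> snd f")
    case True
    then have "X \<in> solids" using Gf(3) by (simp add: X_def)
    from card_lines_through(2)[OF Q(1) QX this] show ?thesis by simp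
  next
    case False
    then have "X \<in> planes" using J by (simp add: X_def)
    from card_lines_through(1)[OF Q(1) QX this] show ?thesis by simp
  qed
  then have "card ({L \<in> lines. Q \<subseteq> L \<and> L \<subseteq> X} - {K}) \<le> q ^ 2 + q"
    using K KX by (subst card_Diff_singleton) auto
  moreover have "inj_on fst ?B" by (rule inj_on_subset[OF inj]) auto
  ultimately show ?thesis using card_le_inj_fst[OF _ sub] by simp
qed

text \<open>If there is such a flag at all, \<open>P\<close> and \<open>fst g\<close> span a plane
  of the solid \<open>snd g\<close>. A line in this plane would meet \<open>fst g\<close>, so only
  the q^2 lines of the solid through \<open>P\<close> outside the plane remain.\<close>

lemma card_disjoint_in_solid_through:
  assumes g: "g \<in> G" and P: "P \<in> points"
  shows "card {f \<in> G. P \<subseteq> fst f \<and> fst f \<inter> fst g = {0} \<and> fst f \<subseteq> snd g} \<le> q ^ 2"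
    (is "card ?A \<le> _")
proof (cases "?A = {}")
  case False
  then have "\<exists>f. f \<in> ?A" unfolding ex_in_conv .
  then obtain f where "f \<in> ?A" ..
  then have f: "f \<in> G" "P \<subseteq> fst f" "fst f \<inter> fst g = {0}" "fst f \<subseteq> snd g" by simp_all
  note Gg = coclique_flag[OF coclique g]
  have Pg: "\<not> P \<subseteq> fst g" using Int_nonzero[OF P f(2), of "fst g"] f(3) by blast
  have E: "join P (fst g) \<in> planes" by (rule join_point_line[OF P Gg(2) Pg])
  have "join P (fst g) \<subseteq> snd g"
    using f(2,4) Gg(4) by (intro join_least subspaces_of_dimD(1)[OF Gg(3)]) auto
  then have count: "card {L \<in> lines. P \<subseteq> L \<and> L \<subseteq> snd g \<and> \<not> L \<subseteq> join P (fst g)} = q ^ 2"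
    by (rule card_lines_through_point_not_in_plane[OF Gg(3) E _ P join_upper1])
  have sub: "fst ` ?A \<subseteq> {L \<in> lines. P \<subseteq> L \<and> L \<subseteq> snd g \<and> \<not> L \<subseteq> join P (fst g)}"
  proof
    fix L assume "L \<in> fst ` ?A"
    then obtain h where h: "h \<in> G" "L = fst h" "P \<subseteq> L" "L \<inter> fst g = {0}" "L \<subseteq> snd g" by auto
    have L: "L \<in> lines" using coclique_flag(2)[OF coclique h(1)] h(2) by simp
    have "\<not> L \<subseteq> join P (fst g)"
      using Int_nonzero_if_dim[OF L Gg(2) E _ join_upper2] h(4) by auto
    with L h show "L \<in> {L \<in> lines. P \<subseteq> L \<and> L \<subseteq> snd g \<and> \<not> L \<subseteq> join P (fst g)}" by simp
  qed
  have "inj_on fst ?A" by (rule inj_on_subset[OF inj]) auto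
  from card_le_inj_fst[OF this sub] count show ?thesis by simp
next
  case True
  show ?thesis unfolding True by simp
qed

text \<open>Let a and b be the numbers of flags at \<open>P\<close> and at \<open>Q\<close>, with
  those on \<open>K\<close> left out. For each pair (f, g), either g meets f or lies in its solid,
  which happens for at most q^2 + q flags g per f, or f is disjoint from g and lies in its solid,
  which happens for at most q^2 flags f per g. Hence a b \<le> a (q^2 + q) + b q^2, and a \<le> b
  bounds the right side by (2 q^2 + q) b.\<close>

lemma star_min:
  assumes P: "P \<in> points" and Q: "Q \<in> points" "Q \<noteq> P" and K: "K \<in> lines" "P \<subseteq> K" "Q \<subseteq> K"
  assumes le: "card {f \<in> G. P \<subseteq> fst f \<and> fst f \<noteq> K} \<le> card {g \<in> G. Q \<subseteq> fst g \<and> fst g \<noteq> K}"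
    (is "card ?A \<le> card ?B")
  shows "card {f \<in> G. P \<subseteq> fst f \<and> fst f \<noteq> K} \<le> 2 * q ^ 2 + q"
proof -
  let ?S = "SIGMA f:?A. {g \<in> G. Q \<subseteq> fst g \<and> fst g \<noteq> K \<and> (fst f \<inter> fst g \<noteq> {0} \<or> fst g \<subseteq> snd f)}"
  let ?T = "SIGMA g:?B. {f \<in> G. P \<subseteq> fst f \<and> fst f \<inter> fst g = {0} \<and> fst f \<subseteq> snd g}"
  have "?A \<times> ?B \<subseteq> ?S \<union> prod.swap ` ?T"
  proof
    fix x assume "x \<in> ?A \<times> ?B"
    then obtain f g where x: "x = (f, g)" and f: "f \<in> ?A" and g: "g \<in> ?B" by blast
    show "x \<in> ?S \<union> prod.swap ` ?T"
    proof (cases "fst f \<inter> fst g \<noteq> {0} \<or> fst g \<subseteq> snd f")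
      case True
      then show ?thesis using x f g by simp
    next
      case False
      then have "fst f \<subseteq> snd g" using cocliqueD[OF coclique, of f g] f g by simp
      then have "(g, f) \<in> ?T" using False f g by simp
      then show ?thesis using x by (intro UnI2 image_eqI[of _ _ "(g, f)"]) simp_all
    qed
  qed
  then have "card (?A \<times> ?B) \<le> card (?S \<union> prod.swap ` ?T)"
    by (intro card_mono) simp
  also have "\<dots> \<le> card ?S + card (prod.swap ` ?T)" by (rule card_Un_le)
  also have "card (prod.swap ` ?T) \<le> card ?T" by (rule card_image_le) simp
  also have "card ?S \<le> card ?A * (q ^ 2 + q)"
  proof -
    have "card ?S = (\<Sum>f\<in>?A. card {g \<in> G. Q \<subseteq> fst g \<and> fst g \<noteq> K \<and> (fst f \<inter> fst g \<noteq> {0} \<or> fst g \<subseteq> snd f)})"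
      by (rule card_SigmaI) simp_all
    also have "\<dots> \<le> of_nat (card ?A) * (q ^ 2 + q)"
      by (rule sum_bounded_above) (use card_meeting_or_in_solid[OF _ P _ Q K] in simp)
    finally show ?thesis by simp
  qed
  also have "card ?T \<le> card ?B * q ^ 2"
  proof -
    have "card ?T = (\<Sum>g\<in>?B. card {f \<in> G. P \<subseteq> fst f \<and> fst f \<inter> fst g = {0} \<and> fst f \<subseteq> snd g})"
      by (rule card_SigmaI) simp_all
    also have "\<dots> \<le> of_nat (card ?B) * q ^ 2"
      by (rule sum_bounded_above) (use card_disjoint_in_solid_through[OF _ P] in simp)
    finally show ?thesis by simp
  qed
  finally have ab: "card ?A * card ?B \<le> card ?A * (q ^ 2 + q) + card ?B * q ^ 2"
    by (simp add: card_cartesian_product)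
  have "card ?A * (q ^ 2 + q) \<le> card ?B * (q ^ 2 + q)" using le by (rule mult_le_mono1)
  with ab have "card ?A * card ?B \<le> (2 * q ^ 2 + q) * card ?B"
    by (simp add: algebra_simps)
  \<comment> \<open>If \<open>?B\<close> is empty, the assumption \<open>le\<close> makes
    \<open>?A\<close> empty too.\<close>
  then have "card ?A \<le> 2 * q ^ 2 + q \<or> card ?B = 0"
    by (simp only: mult_le_cancel2) linarith
  then show ?thesis using le by linarith
qed

text \<open>By \<open>star_min\<close> at most one of the q + 1 points of \<open>fst f\<close> lies
  on more than 2 q^2 + q further lines of \<open>G\<close>. This point contributes at most q^3 + q^2
  + q, the number of other lines through it, and the remaining q points at most 2 q^2 + q
  each.\<close>

lemma card_meeting:
  assumes f: "f \<in> G"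
  shows "card {g \<in> G. fst g \<noteq> fst f \<and> fst f \<inter> fst g \<noteq> {0}} \<le> 3 * q ^ 3 + 2 * q ^ 2 + q"
    (is "card ?M \<le> _")
proof -
  note Gf = coclique_flag[OF coclique f]
  define R where "R = {P \<in> points. P \<subseteq> fst f}"
  define A where "A P = {g \<in> G. P \<subseteq> fst g \<and> fst g \<noteq> fst f}" for P
  have M: "?M \<subseteq> (\<Union>P\<in>R. A P)"
  proof
    fix g assume "g \<in> ?M"
    then have g: "g \<in> G" "fst g \<noteq> fst f" "fst f \<inter> fst g \<noteq> {0}" by simp_all
    obtain P where "P \<in> points" "P \<subseteq> fst f" "P \<subseteq> fst g"
      by (rule common_point[OF Gf(2) coclique_flag(2)[OF coclique g(1)] g(3)])
    with g have "P \<in> R" "g \<in> A P" by (simp_all add: R_def A_def)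
    then show "g \<in> (\<Union>P\<in>R. A P)" by blast
  qed
  have cR: "card R = q + 1" unfolding R_def by (rule card_points_numeral(1)[OF Gf(2)])
  have A_le: "card (A P) \<le> q ^ 3 + q ^ 2 + q" if "P \<in> R" for P
  proof -
    have "fst ` A P \<subseteq> {L \<in> lines. P \<subseteq> L} - {fst f}"
      using coclique_flag(2)[OF coclique] unfolding A_def by auto
    moreover have "inj_on fst (A P)" by (rule inj_on_subset[OF inj]) (simp add: A_def)
    ultimately have "card (A P) \<le> card ({L \<in> lines. P \<subseteq> L} - {fst f})"
      by (rule card_le_inj_fst[rotated])
    also have "\<dots> = q ^ 3 + q ^ 2 + q"
      using card_lines_through_5[of P] that Gf(2) by (subst card_Diff_singleton) (auto simp: R_def)
    finally show ?thesis .
  qed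
  have small: "card (A P) \<le> 2 * q ^ 2 + q \<or> card (A Q) \<le> 2 * q ^ 2 + q"
    if "P \<in> R" "Q \<in> R" "P \<noteq> Q" for P Q
  proof (cases "card (A P) \<le> card (A Q)")
    case True
    then have "card (A P) \<le> 2 * q ^ 2 + q"
      unfolding A_def using that Gf(2) by (intro star_min[of P Q]) (simp_all add: R_def)
    then show ?thesis ..
  next
    case False
    then have "card (A Q) \<le> 2 * q ^ 2 + q"
      unfolding A_def using that Gf(2) by (intro star_min[of Q P]) (simp_all add: R_def)
    then show ?thesis ..
  qed
  show ?thesis
  proof (cases "\<forall>P\<in>R. card (A P) \<le> 2 * q ^ 2 + q")
    case True
    have "card ?M \<le> card R * (2 * q ^ 2 + q)"
      by (rule card_le_UN[OF _ _ M]) (use True in auto)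
    also have "\<dots> = 2 * q ^ 3 + 3 * q ^ 2 + q"
      unfolding cR by (simp add: algebra_simps power2_eq_square power3_eq_cube)
    also have "\<dots> \<le> 3 * q ^ 3 + 2 * q ^ 2 + q"
      using power_increasing[of 2 3 q] q_ge_2 by simp
    finally show ?thesis .
  next
    case False
    then obtain P where P: "P \<in> R" "\<not> card (A P) \<le> 2 * q ^ 2 + q" by blast
    have "?M \<subseteq> A P \<union> (\<Union>Q\<in>R - {P}. A Q)" using M by blast
    then have "card ?M \<le> card (A P \<union> (\<Union>Q\<in>R - {P}. A Q))" by (intro card_mono) auto
    also have "\<dots> \<le> card (A P) + card (\<Union>Q\<in>R - {P}. A Q)" by (rule card_Un_le)
    also have "card (\<Union>Q\<in>R - {P}. A Q) \<le> card (R - {P}) * (2 * q ^ 2 + q)"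
    proof (rule card_le_UN)
      show "card (A Q) \<le> 2 * q ^ 2 + q" if "Q \<in> R - {P}" for Q
        using small[of P Q] that P by blast
    qed auto
    also have "card (R - {P}) = q" using cR P(1) by (subst card_Diff_singleton) auto
    also have "card (A P) \<le> q ^ 3 + q ^ 2 + q" by (rule A_le[OF P(1)])
    finally show ?thesis by (simp add: algebra_simps power2_eq_square power3_eq_cube)
  qed
qed

text \<open>All ordered pairs of flags are sorted into equal pairs, pairs with distinct meeting
  lines, and disjoint pairs in which one line lies in the solid of the other. The last kind is
  counted from the flag that owns the solid, with at most q^4 partners, once for each order of the
  pair. Dividing by the number of flags gives the bound.\<close>

lemma card_light_coclique: "card G \<le> 2 * q ^ 4 + 3 * q ^ 3 + 2 * q ^ 2 + q + 1"
proof -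
  define D where "D = 3 * q ^ 3 + 2 * q ^ 2 + q"
  let ?S = "SIGMA f:G. {g \<in> G. fst g \<noteq> fst f \<and> fst f \<inter> fst g \<noteq> {0}}"
  let ?T = "SIGMA f:G. {g \<in> G. fst g \<subseteq> snd f \<and> fst g \<inter> fst f = {0}}"
  have "G \<times> G \<subseteq> (\<lambda>f. (f, f)) ` G \<union> ?S \<union> ?T \<union> prod.swap ` ?T"
  proof
    fix x assume "x \<in> G \<times> G"
    then obtain f g where x: "x = (f, g)" and f: "f \<in> G" and g: "g \<in> G" by blast
    consider "fst f = fst g" | "fst f \<noteq> fst g" "fst f \<inter> fst g \<noteq> {0}"
      | "fst f \<inter> fst g = {0}" "fst g \<subseteq> snd f" | "fst f \<inter> fst g = {0}" "fst f \<subseteq> snd g"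
      using cocliqueD[OF coclique f g] by blast
    then show "x \<in> (\<lambda>f. (f, f)) ` G \<union> ?S \<union> ?T \<union> prod.swap ` ?T"
    proof cases
      case 1
      then have "f = g" using inj f g by (rule_tac inj_onD)
      then show ?thesis using x f by simp
    next
      case 2
      then show ?thesis using x f g by auto
    next
      case 3
      then show ?thesis using x f g by (simp add: Int_commute)
    next
      case 4
      then have "(g, f) \<in> ?T" using f g by simp
      then show ?thesis using x by (intro UnI2 image_eqI[of _ _ "(g, f)"]) simp_all
    qed
  qed
  then have "card (G \<times> G) \<le> card ((\<lambda>f. (f, f)) ` G \<union> ?S \<union> ?T \<union> prod.swap ` ?T)"
    by (intro card_mono) simp
  also have "\<dots> \<le> card ((\<lambda>f. (f, f)) ` G) + card ?S + card ?T + card (prod.swap ` ?T)"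
    by (meson add_le_mono card_Un_le le_refl order_trans)
  also have "card ((\<lambda>f. (f, f)) ` G) \<le> card G" by (rule card_image_le) simp
  also have "card (prod.swap ` ?T) \<le> card ?T" by (rule card_image_le) simp
  also have "card ?S \<le> card G * D"
  proof -
    have "card ?S = (\<Sum>f\<in>G. card {g \<in> G. fst g \<noteq> fst f \<and> fst f \<inter> fst g \<noteq> {0}})"
      by (rule card_SigmaI) simp_all
    also have "\<dots> \<le> of_nat (card G) * D"
      unfolding D_def by (rule sum_bounded_above) (rule card_meeting)
    finally show ?thesis by simp
  qed
  also have "card ?T \<le> card G * q ^ 4"
  proof -
    have "card {g \<in> G. fst g \<subseteq> snd f \<and> fst g \<inter> fst f = {0}} \<le> q ^ 4" (is "card ?X \<le> _") if f: "f \<in> G" for f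
    proof -
      note Gf = coclique_flag[OF coclique f]
      have "fst ` ?X \<subseteq> {M \<in> lines. M \<subseteq> snd f \<and> M \<inter> fst f = {0}}"
        using coclique_flag(2)[OF coclique] by auto
      moreover have "inj_on fst ?X" by (rule inj_on_subset[OF inj]) auto
      ultimately have "card ?X \<le> card {M \<in> lines. M \<subseteq> snd f \<and> M \<inter> fst f = {0}}"
        by (intro card_le_inj_fst)
      also have "\<dots> \<le> q ^ 4" by (rule card_lines_in_solid_disjoint[OF Gf(3,2,4)])
      finally show ?thesis .
    qed
    moreover have "card ?T = (\<Sum>f\<in>G. card {g \<in> G. fst g \<subseteq> snd f \<and> fst g \<inter> fst f = {0}})"
      by (rule card_SigmaI) simp_all
    ultimately show ?thesis
      using sum_bounded_above[of G "\<lambda>f. card {g \<in> G. fst g \<subseteq> snd f \<and> fst g \<inter> fst f = {0}}" "q ^ 4"]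
      by simp
  qed
  finally have "card G * card G \<le> card G * (1 + D + 2 * q ^ 4)"
    by (simp add: card_cartesian_product algebra_simps)
  then have "card G \<le> 1 + D + 2 * q ^ 4 \<or> card G = 0"
    by (simp only: mult_le_cancel1) linarith
  then have "card G \<le> 1 + D + 2 * q ^ 4" by linarith
  then show ?thesis by (simp add: D_def)
qed

end

section \<open>Cocliques without a common point\<close>

context gf_space
begin

text \<open>The flags on a single heavy line number at most q^2 + q + 1, and all others form a light
  coclique. The sum of the two bounds stays below the claim by q^2 - 1. The case without heavy lines
  is covered, with an empty heavy part.\<close>

lemma card_le_if_single_heavy:
  fixes F :: "(('a ^ 5) set \<times> ('a ^ 5) set) set"
  assumes F: "coclique F" and single: "\<And>L. heavy F L \<Longrightarrow> L = L0"
  shows "card F \<le> (q ^ 2 + q + 1) * (2 * q ^ 2 + q + 1)"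
proof -
  define G where "G = {f \<in> F. \<not> heavy F (fst f)}"
  have "coclique G" by (rule coclique_subset[OF F]) (simp add: G_def)
  moreover have "inj_on fst G" unfolding G_def by (rule inj_on_fst_light)
  ultimately interpret light_coclique q field_type G by unfold_locales
  have G: "card G \<le> 2 * q ^ 4 + 3 * q ^ 3 + 2 * q ^ 2 + q + 1"
    by (rule card_light_coclique)
  define X where "X = {f \<in> F. heavy F (fst f)}"
  have "card X \<le> q ^ 2 + q + 1"
  proof (cases "X = {}")
    case False
    then obtain f where f: "f \<in> X" by blast
    have L0: "L0 \<in> lines"
      using heavy_line[OF F, of "fst f"] single[of "fst f"] f by (simp add: X_def)
    have "card X \<le> card {L0} * (q ^ 2 + q + 1)"
    proof (rule card_flags_le)
      show "X \<subseteq> line_solid_flags" using coclique_flag(1)[OF F] by (auto simp: X_def)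
      show "fst ` X \<subseteq> {L0}" using single by (auto simp: X_def)
    qed (use L0 in simp)
    then show ?thesis by simp
  qed simp
  moreover have "F = G \<union> X" by (auto simp: G_def X_def)
  then have "card F \<le> card G + card X" using card_Un_le by metis
  ultimately have "card F \<le> 2 * q ^ 4 + 3 * q ^ 3 + 3 * q ^ 2 + 2 * q + 2"
    using G by simp
  also have "\<dots> \<le> 2 * q ^ 4 + 3 * q ^ 3 + 4 * q ^ 2 + 2 * q + 1"
    using power_increasing[of 0 2 q] q_ge_2 by simp
  also have "\<dots> = (q ^ 2 + q + 1) * (2 * q ^ 2 + q + 1)"
    by (simp add: algebra_simps eval_nat_numeral)
  finally show ?thesis .
qed

text \<open>Two of these flags with different solids have the point of the plane \<open>E\<close> on their lines in
  common.\<close>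
lemma card_solid_through_plane_le:
  fixes F :: "(('a ^ 5) set \<times> ('a ^ 5) set) set"
  assumes F: "coclique F" and E: "E \<in> planes"
  shows "card {f \<in> F. \<not> fst f \<subseteq> E \<and> E \<subseteq> snd f} \<le> q ^ 2 * (q ^ 2 + q + 1)" (is "card ?C \<le> _")
proof -
  have sp: "vec.subspace E" by (rule subspaces_of_dimD(1)[OF E])
  have eqE: "snd f \<inter> snd g = E" if "f \<in> ?C" "g \<in> ?C" "snd f \<noteq> snd g" for f g
  proof -
    have "snd f \<inter> snd g \<in> planes"
      using that coclique_flag(3)[OF F] by (intro solids_Int) simp_all
    from subspaces_of_dim_eqI[OF E this] show ?thesis using that by simp
  qed
  \<comment> \<open>A line in two different solids of \<open>?C\<close> would lie in their
    intersection, which is \<open>E\<close>.\<close>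
  have inj: "inj_on fst ?C"
  proof (rule inj_onI)
    fix f g assume fg: "f \<in> ?C" "g \<in> ?C" "fst f = fst g"
    have "snd f = snd g"
    proof (rule ccontr)
      assume "snd f \<noteq> snd g"
      from eqE[OF fg(1,2) this] have "snd f \<inter> snd g \<subseteq> E" by simp
      moreover have "fst f \<subseteq> snd f \<inter> snd g"
        using coclique_flag(4)[OF F, of f] coclique_flag(4)[OF F, of g] fg by (intro Int_greatest) simp_all
      ultimately have "fst f \<subseteq> E" by (rule subset_trans[rotated])
      with fg(1) show False by simp
    qed
    with fg(3) show "f = g" by (simp add: prod_eq_iff)
  qed
  \<comment> \<open>Neither line lies in the solid of the other flag, since it would then lie in the
    intersection \<open>E\<close> of the solids. So the lines meet; the meeting point is in both
    solids and thus in \<open>E\<close>, where \<open>fst f\<close> has \<open>P\<close> as its only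
    point.\<close>
  have common: "P \<subseteq> fst g"
    if "f \<in> ?C" "g \<in> ?C" "snd f \<noteq> snd g" "P \<in> points" "P \<subseteq> fst f" "P \<subseteq> E" for f g P
  proof -
    note fF = coclique_flag[OF F, of f] and gF = coclique_flag[OF F, of g]
    have "\<not> fst f \<subseteq> snd g"
    proof
      assume "fst f \<subseteq> snd g"
      then have "fst f \<subseteq> snd f \<inter> snd g" using fF(4) that(1) by simp
      then have "fst f \<subseteq> E" unfolding eqE[OF that(1-3)] .
      with that(1) show False by simp
    qed
    moreover have "\<not> fst g \<subseteq> snd f"
    proof
      assume "fst g \<subseteq> snd f"
      then have "fst g \<subseteq> snd f \<inter> snd g" using gF(4) that(2) by simp
      then have "fst g \<subseteq> E" unfolding eqE[OF that(1-3)] .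
      with that(2) show False by simp
    qed
    moreover have fg: "f \<in> F" "g \<in> F" using that(1,2) by simp_all
    ultimately have meet: "fst f \<inter> fst g \<noteq> {0}"
      using cocliqueD[OF F, of f g] by metis
    obtain R where R: "R \<in> points" "R \<subseteq> fst f" "R \<subseteq> fst g"
      by (rule common_point[OF fF(2)[OF fg(1)] gF(2)[OF fg(2)] meet])
    have "R \<subseteq> snd f \<inter> snd g"
      using subset_trans[OF R(2) fF(4)] subset_trans[OF R(3) gF(4)] that(1,2) by simp
    then have RE: "R \<subseteq> E" using eqE[OF that(1-3)] by simp
    have "R = P"
    proof (rule ccontr)
      assume "R \<noteq> P"
      from line_subset[OF R(1) that(4) this fF(2) R(2) that(5) sp RE that(6)] that(1)
      show False by simp
    qed
    with R(3) show ?thesis by simp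
  qed
  show ?thesis
  proof (cases "\<exists>f\<in>?C. \<exists>g\<in>?C. snd f \<noteq> snd g")
    case False
    show ?thesis
    proof (cases "?C = {}")
      case True
      show ?thesis unfolding True by simp
    next
      case C: False
      then have "\<exists>f. f \<in> ?C" unfolding ex_in_conv .
      then obtain f where f: "f \<in> ?C" ..
      have "fst ` ?C \<subseteq> {L \<in> lines. L \<subseteq> snd f \<and> \<not> L \<subseteq> E}"
      proof
        fix L assume "L \<in> fst ` ?C"
        then obtain g where g: "g \<in> ?C" "L = fst g" by (rule imageE)
        moreover from False f g(1) have "snd g = snd f" by meson
        ultimately show "L \<in> {L \<in> lines. L \<subseteq> snd f \<and> \<not> L \<subseteq> E}"
          using coclique_flag[OF F, of g] by simp
      qed
      from card_le_inj_fst[OF inj this] show ?thesis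
        using card_lines_in_solid_not_in_plane[of "snd f" E] E f coclique_flag(3)[OF F, of f] by simp
    qed
  next
    case True
    then obtain f g where f: "f \<in> ?C" and g: "g \<in> ?C" and ne: "snd f \<noteq> snd g" by meson
    have "f \<in> F" using f by simp
    note H = coclique_flag[OF F this]
    have "fst f \<inter> E \<noteq> {0}"
      by (rule Int_nonzero_if_dim[OF H(2) E H(3,4)]) (use f in simp_all)
    then obtain P where P: "P \<in> points" "P \<subseteq> fst f" "P \<subseteq> E"
      by (rule common_point[OF H(2) E])
    have Pg: "P \<subseteq> fst g" by (rule common[OF f g ne P])
    \<comment> \<open>Every further flag has a solid different from that of \<open>f\<close> or from
      that of \<open>g\<close>, so \<open>P\<close> passes on to its line from one of the
      two.\<close>
    have "fst ` ?C \<subseteq> {L \<in> lines. P \<subseteq> L}"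
    proof
      fix L assume "L \<in> fst ` ?C"
      then obtain h where h: "h \<in> ?C" "L = fst h" by (rule imageE)
      have "P \<subseteq> fst h"
      proof (cases "snd h = snd f")
        case True
        then show ?thesis using common[OF g h(1) _ P(1) Pg P(3)] ne by simp
      next
        case False
        then show ?thesis using common[OF f h(1) _ P] by simp
      qed
      then show "L \<in> {L \<in> lines. P \<subseteq> L}"
        using h coclique_flag(2)[OF F, of h] by simp
    qed
    from card_le_inj_fst[OF inj this] have "card ?C \<le> q ^ 3 + q ^ 2 + q + 1"
      by (simp only: card_lines_through_5[OF P(1)])
    also have "\<dots> \<le> q ^ 2 * (q ^ 2 + q + 1)"
    proof -
      have "2 * q \<le> q * q" "2 * (q * q) \<le> q * (q * q)" "2 * (q * (q * q)) \<le> q * (q * (q * q))"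
        using q_ge_2 by simp_all
      then show ?thesis using q_ge_2 by (simp add: algebra_simps eval_nat_numeral)
    qed
    finally show ?thesis .
  qed
qed

text \<open>The flags split into those with line in \<open>E\<close> (\<open>On\<close>), those with
  only the solid incident with \<open>E\<close> (\<open>C\<close>), and the rest (\<open>A\<close>).
  If \<open>A\<close> is empty, the bounds for \<open>On\<close> and \<open>C\<close> add up exactly
  to the claim. A flag in \<open>A\<close> forces all heavy lines through the point
  \<open>P\<close>; then few flags are heavy, and light flags are counted by their lines, which lie
  in \<open>E\<close> or pass through \<open>P\<close> unless the flag is in
  \<open>C\<close>.\<close>

lemma card_le_if_heavy_coplanar:
  fixes F :: "(('a ^ 5) set \<times> ('a ^ 5) set) set"
  assumes F: "coclique F" and L1: "heavy F L1" and L2: "heavy F L2" and ne: "L1 \<noteq> L2"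
    and E: "E \<in> planes" and coplanar: "\<And>L. heavy F L \<Longrightarrow> L \<subseteq> E"
  shows "card F \<le> (q ^ 2 + q + 1) * (2 * q ^ 2 + q + 1)"
proof -
  note sp = subspaces_of_dimD(1)
  have L: "L1 \<in> lines" "L2 \<in> lines" using heavy_line[OF F] L1 L2 by simp_all
  obtain P where P: "P \<in> points" "P \<subseteq> L1" "P \<subseteq> L2" and J: "join L1 L2 \<in> planes"
    and u: "\<forall>Q\<in>points. Q \<subseteq> L1 \<longrightarrow> Q \<subseteq> L2 \<longrightarrow> Q = P"
    by (rule meeting_point[OF L ne heavy_lines_meet[OF F L1 L2]])
  have uniq: "Q = P" if "Q \<in> points" "Q \<subseteq> L1" "Q \<subseteq> L2" for Q
    by (rule u[THEN bspec, THEN mp, THEN mp, OF that])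
  have PE: "P \<subseteq> E" using P(2) coplanar[OF L1] by (rule subset_trans)
  have JE: "join L1 L2 = E"
    by (rule subspaces_of_dim_eqI[OF J E]) (rule join_least[OF sp[OF E] coplanar[OF L1] coplanar[OF L2]])
  define On where "On = {f \<in> F. fst f \<subseteq> E}"
  define C where "C = {f \<in> F. \<not> fst f \<subseteq> E \<and> E \<subseteq> snd f}"
  define A where "A = {f \<in> F. \<not> fst f \<subseteq> E \<and> \<not> E \<subseteq> snd f}"
  have C_le: "card C \<le> q ^ 2 * (q ^ 2 + q + 1)"
    unfolding C_def by (rule card_solid_through_plane_le[OF F E])
  \<comment> \<open>If \<open>L\<close> misses \<open>fst f\<close>, it lies in
    \<open>snd f\<close>. Since \<open>E\<close> does not, \<open>L1\<close> or \<open>L2\<close> is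
    outside \<open>snd f\<close> and therefore meets \<open>fst f\<close>, in a point of
    \<open>E\<close> off \<open>L\<close>. This point and \<open>L\<close> span \<open>E\<close>
    within \<open>snd f\<close>, a contradiction.\<close>
  have A_meet: "L \<inter> fst f \<noteq> {0}" if f: "f \<in> A" and L: "heavy F L" for f L
  proof
    assume disj: "L \<inter> fst f = {0}"
    have fF: "f \<in> F" "\<not> E \<subseteq> snd f" using f by (simp_all add: A_def)
    note H = coclique_flag[OF F fF(1)]
    have LH: "L \<subseteq> snd f" by (rule heavy_subset_solid[OF F L fF(1) disj])
    have "\<not> (L1 \<subseteq> snd f \<and> L2 \<subseteq> snd f)"
      using join_least[OF sp[OF H(3)], of L1 L2] JE fF(2) by blast
    then obtain M where M: "heavy F M" "\<not> M \<subseteq> snd f" using L1 L2 by blast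
    have "M \<inter> fst f \<noteq> {0}" using heavy_subset_solid[OF F M(1) fF(1)] M(2) by blast
    then obtain R where R: "R \<in> points" "R \<subseteq> M" "R \<subseteq> fst f"
      by (rule common_point[OF heavy_line[OF F M(1)] H(2)])
    have RL: "\<not> R \<subseteq> L" using Int_nonzero[OF R(1) _ R(3), of L] disj by blast
    have "join R L \<in> planes" by (rule join_point_line[OF R(1) heavy_line[OF F L] RL])
    moreover have "join R L \<subseteq> E"
      by (rule join_least[OF sp[OF E] subset_trans[OF R(2) coplanar[OF M(1)]] coplanar[OF L]])
    ultimately have "join R L = E" using subspaces_of_dim_eqI E by blast
    moreover have "join R L \<subseteq> snd f"
      by (rule join_least[OF sp[OF H(3)] subset_trans[OF R(3) H(4)] LH])
    ultimately show False using fF(2) by simp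
  qed
  \<comment> \<open>The line of \<open>f\<close> has only one point in \<open>E\<close>. All heavy
    lines meet \<open>fst f\<close> and lie in \<open>E\<close>, so they pass through that point,
    which must be the common point of \<open>L1\<close> and \<open>L2\<close>.\<close>
  have A_point: "R = P" "P \<subseteq> fst f"
    if f: "f \<in> A" and R: "R \<in> points" "R \<subseteq> fst f" "R \<subseteq> E" for f R
  proof -
    have fF: "f \<in> F" "\<not> fst f \<subseteq> E" using f by (simp_all add: A_def)
    note f_line = coclique_flag(2)[OF F fF(1)]
    have on: "R \<subseteq> L" if L: "heavy F L" for L
    proof -
      obtain S where S: "S \<in> points" "S \<subseteq> L" "S \<subseteq> fst f"
        by (rule common_point[OF heavy_line[OF F L] f_line A_meet[OF f L]])
      have "S = R"
      proof (rule ccontr)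
        assume "S \<noteq> R"
        from line_subset[OF S(1) R(1) this f_line S(3) R(2) sp[OF E]
          subset_trans[OF S(2) coplanar[OF L]] R(3)] fF(2) show False by simp
      qed
      with S(2) show ?thesis by simp
    qed
    show "R = P" by (rule uniq[OF R(1) on[OF L1] on[OF L2]])
    with R(2) show "P \<subseteq> fst f" by simp
  qed
  have A_heavy: "P \<subseteq> fst f \<and> P \<subseteq> L" if f: "f \<in> A" and L: "heavy F L" for f L
  proof -
    have "f \<in> F" using f by (simp add: A_def)
    note f_line = coclique_flag(2)[OF F this]
    obtain S where S: "S \<in> points" "S \<subseteq> L" "S \<subseteq> fst f"
      by (rule common_point[OF heavy_line[OF F L] f_line A_meet[OF f L]])
    have "S \<subseteq> E" using S(2) coplanar[OF L] by (rule subset_trans)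
    from A_point[OF f S(1,3) this] S(2) show ?thesis by simp
  qed
  have F_split: "F = On \<union> C \<union> A" unfolding On_def C_def A_def by blast
  have lines_E: "card {L \<in> lines. L \<subseteq> E} = q ^ 2 + q + 1" by (rule card_lines_in_plane[OF E])
  show ?thesis
  proof (cases "A = {}")
    case True
    have "card On \<le> card {L \<in> lines. L \<subseteq> E} * (q ^ 2 + q + 1)"
    proof (rule card_flags_le)
      show "On \<subseteq> line_solid_flags" using coclique_flag(1)[OF F] unfolding On_def by blast
      show "fst ` On \<subseteq> {L \<in> lines. L \<subseteq> E}" using coclique_flag(2)[OF F] unfolding On_def by auto
    qed simp
    moreover have "card F \<le> card On + card C"
      using F_split True card_Un_le[of On C] by simp
    ultimately have "card F \<le> (q ^ 2 + q + 1) * (q ^ 2 + q + 1) + q ^ 2 * (q ^ 2 + q + 1)"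
      using C_le unfolding lines_E by linarith
    then show ?thesis by (simp add: algebra_simps)
  next
    case False
    then obtain a where a: "a \<in> A" by blast
    define X where "X = {f \<in> F. heavy F (fst f)}"
    define Y where "Y = {f \<in> F. \<not> heavy F (fst f)}"
    have "card X \<le> card {L \<in> lines. P \<subseteq> L \<and> L \<subseteq> E} * (q ^ 2 + q + 1)"
    proof (rule card_flags_le)
      show "X \<subseteq> line_solid_flags" using coclique_flag(1)[OF F] unfolding X_def by blast
      show "fst ` X \<subseteq> {L \<in> lines. P \<subseteq> L \<and> L \<subseteq> E}"
      proof
        fix L assume "L \<in> fst ` X"
        then have L: "heavy F L" by (auto simp: X_def)
        from heavy_line[OF F L] A_heavy[OF a L] coplanar[OF L]
        show "L \<in> {L \<in> lines. P \<subseteq> L \<and> L \<subseteq> E}" by simp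
      qed
    qed simp
    then have X_le: "card X \<le> (q + 1) * (q ^ 2 + q + 1)"
      by (simp only: card_lines_through(1)[OF P(1) PE E])
    have inj: "inj_on fst Y" unfolding Y_def by (rule inj_on_fst_light)
    have "card (On \<inter> Y) \<le> card {L \<in> lines. L \<subseteq> E}"
    proof (rule card_le_inj_fst)
      show "inj_on fst (On \<inter> Y)" by (rule inj_on_subset[OF inj]) simp
      show "fst ` (On \<inter> Y) \<subseteq> {L \<in> lines. L \<subseteq> E}"
        using coclique_flag(2)[OF F] unfolding On_def by auto
    qed
    moreover have "card (A \<inter> Y) \<le> card {L \<in> lines. P \<subseteq> L}"
    proof (rule card_le_inj_fst)
      show "inj_on fst (A \<inter> Y)" by (rule inj_on_subset[OF inj]) simp
      show "fst ` (A \<inter> Y) \<subseteq> {L \<in> lines. P \<subseteq> L}"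
      proof
        fix L assume "L \<in> fst ` (A \<inter> Y)"
        then obtain f where "f \<in> A \<inter> Y" "L = fst f" by (rule imageE)
        then show "L \<in> {L \<in> lines. P \<subseteq> L}"
          using A_heavy[OF _ L1, of f] coclique_flag(2)[OF F, of f] by (simp add: A_def)
      qed
    qed
    moreover have "F \<subseteq> X \<union> (On \<inter> Y) \<union> C \<union> (A \<inter> Y)"
      unfolding X_def Y_def using F_split by blast
    then have "card F \<le> card (X \<union> (On \<inter> Y) \<union> C \<union> (A \<inter> Y))" by (intro card_mono) simp
    then have "card F \<le> card X + card (On \<inter> Y) + card C + card (A \<inter> Y)"
      using card_Un_le[of "X \<union> (On \<inter> Y) \<union> C" "A \<inter> Y"] card_Un_le[of "X \<union> (On \<inter> Y)" C]
        card_Un_le[of X "On \<inter> Y"] by linarith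
    ultimately have "card F \<le> (q + 1) * (q ^ 2 + q + 1) + (q ^ 2 + q + 1)
        + q ^ 2 * (q ^ 2 + q + 1) + (q ^ 3 + q ^ 2 + q + 1)"
      using X_le C_le unfolding lines_E card_lines_through_5[OF P(1)] by linarith
    also have "\<dots> \<le> (q ^ 2 + q + 1) * (2 * q ^ 2 + q + 1)"
    proof -
      have "2 * q \<le> q * q" "2 * (q * q) \<le> q * (q * q)" "2 * (q * (q * q)) \<le> q * (q * (q * q))"
        using q_ge_2 by simp_all
      then show ?thesis using q_ge_2 by (simp add: algebra_simps eval_nat_numeral)
    qed
    finally show ?thesis .
  qed
qed

text \<open>Pairwise meeting lines that are not coplanar share a point \<open>P\<close>, and
  \<open>L1\<close>, \<open>L2\<close>, \<open>L3\<close> span a solid \<open>W\<close>. Every flag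
  whose line misses \<open>P\<close> has solid \<open>W\<close>, and such a flag exists by
  \<open>no_common\<close>, so all heavy lines lie in \<open>W\<close>. The flags are split by
  whether the line contains \<open>P\<close> and, if so, whether it lies in \<open>W\<close>. If
  some line through \<open>P\<close> leaves \<open>W\<close>, the flags on such lines are light and
  the flags missing \<open>P\<close> are confined to a plane; otherwise two counts in
  \<open>W\<close> add up exactly to the claim.\<close>

lemma card_le_if_heavy_not_coplanar:
  fixes F :: "(('a ^ 5) set \<times> ('a ^ 5) set) set"
  assumes F: "coclique F" and L1: "heavy F L1" and L2: "heavy F L2" and ne: "L1 \<noteq> L2"
    and L3: "heavy F L3" and off: "\<not> L3 \<subseteq> join L1 L2"
    and no_common: "\<And>P. P \<in> points \<Longrightarrow> \<exists>f\<in>F. \<not> P \<subseteq> fst f"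
  shows "card F \<le> (q ^ 2 + q + 1) * (2 * q ^ 2 + q + 1)"
proof -
  note sp = subspaces_of_dimD(1) and hl = heavy_line[OF F] and meet = heavy_lines_meet[OF F]
  define E where "E = join L1 L2"
  obtain P where P: "P \<in> points" "P \<subseteq> L1" "P \<subseteq> L2" and E: "E \<in> planes"
    and u: "\<forall>Q\<in>points. Q \<subseteq> L1 \<longrightarrow> Q \<subseteq> L2 \<longrightarrow> Q = P"
    unfolding E_def by (rule meeting_point[OF hl[OF L1] hl[OF L2] ne meet[OF L1 L2]])
  have uniq: "Q = P" if "Q \<in> points" "Q \<subseteq> L1" "Q \<subseteq> L2" for Q
    by (rule u[THEN bspec, THEN mp, THEN mp, OF that])
  have L12: "L1 \<subseteq> E" "L2 \<subseteq> E" unfolding E_def by (rule join_upper1, rule join_upper2)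
  have off: "\<not> L3 \<subseteq> E" using off by (simp add: E_def)
  have PE: "P \<subseteq> E" using P(2) L12(1) by (rule subset_trans)
  have E_point: "Q = R"
    if "Q \<in> points" "R \<in> points" "Q \<subseteq> L3" "R \<subseteq> L3" "Q \<subseteq> E" "R \<subseteq> E" for Q R
    using line_subset[OF that(1,2) _ hl[OF L3] that(3,4) sp[OF E] that(5,6)] off by blast
  have P3: "P \<subseteq> L3"
  proof -
    obtain Q where Q: "Q \<in> points" "Q \<subseteq> L1" "Q \<subseteq> L3"
      by (rule common_point[OF hl[OF L1] hl[OF L3] meet[OF L1 L3]])
    obtain R where R: "R \<in> points" "R \<subseteq> L2" "R \<subseteq> L3"
      by (rule common_point[OF hl[OF L2] hl[OF L3] meet[OF L2 L3]])
    have "Q = R"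
      by (rule E_point[OF Q(1) R(1) Q(3) R(3) subset_trans[OF Q(2) L12(1)] subset_trans[OF R(2) L12(2)]])
    then have "Q = P" using uniq[OF Q(1,2)] R(2) by simp
    with Q(3) show ?thesis by simp
  qed
  \<comment> \<open>A heavy line off \<open>P\<close> would meet \<open>L1\<close> and
    \<open>L2\<close> in different points and so lie in \<open>E\<close>. But it also meets
    \<open>L3\<close>, whose only point in \<open>E\<close> is \<open>P\<close>.\<close>
  have through: "P \<subseteq> M" if M: "heavy F M" for M
  proof (rule ccontr)
    assume PM: "\<not> P \<subseteq> M"
    obtain Q where Q: "Q \<in> points" "Q \<subseteq> L1" "Q \<subseteq> M"
      by (rule common_point[OF hl[OF L1] hl[OF M] meet[OF L1 M]])
    obtain R where R: "R \<in> points" "R \<subseteq> L2" "R \<subseteq> M"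
      by (rule common_point[OF hl[OF L2] hl[OF M] meet[OF L2 M]])
    obtain S where S: "S \<in> points" "S \<subseteq> L3" "S \<subseteq> M"
      by (rule common_point[OF hl[OF L3] hl[OF M] meet[OF L3 M]])
    have "Q \<noteq> R" using uniq[OF Q(1,2)] R(2) Q(3) PM by blast
    then have "M \<subseteq> E"
      by (rule line_subset[OF Q(1) R(1) _ hl[OF M] Q(3) R(3) sp[OF E]
        subset_trans[OF Q(2) L12(1)] subset_trans[OF R(2) L12(2)]])
    with S(3) have "S \<subseteq> E" by (rule subset_trans)
    then have "S = P" by (rule E_point[OF S(1) P(1) S(2) P3 _ PE])
    with S(3) PM show False by simp
  qed
  have all_in: "M \<subseteq> snd f" if f: "f \<in> F" "\<not> P \<subseteq> fst f" and M: "heavy F M" for f M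
  proof -
    note H = coclique_flag[OF F f(1)]
    have meets: "K \<subseteq> X"
      if K: "heavy F K" "K \<inter> fst f \<noteq> {0}" and X: "vec.subspace X" "P \<subseteq> X" "fst f \<subseteq> X" for K X
    proof -
      obtain Q where Q: "Q \<in> points" "Q \<subseteq> K" "Q \<subseteq> fst f"
        by (rule common_point[OF hl[OF K(1)] H(2) K(2)])
      have "Q \<noteq> P" using Q(3) f(2) by blast
      then show ?thesis
        by (rule line_subset[OF Q(1) P(1) _ hl[OF K(1)] Q(2) through[OF K(1)] X(1)
          subset_trans[OF Q(3) X(3)] X(2)])
    qed
    \<comment> \<open>If every heavy line met \<open>fst f\<close>, all of them would lie in the
      plane spanned by \<open>P\<close> and \<open>fst f\<close>, contrary to \<open>off\<close>. A
      heavy line disjoint from \<open>fst f\<close> lies in \<open>snd f\<close> and brings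
      \<open>P\<close> into it.\<close>
    have "\<exists>K. heavy F K \<and> K \<inter> fst f = {0}"
    proof (rule ccontr)
      assume no: "\<not> (\<exists>K. heavy F K \<and> K \<inter> fst f = {0})"
      have J: "join P (fst f) \<in> planes" by (rule join_point_line[OF P(1) H(2) f(2)])
      have sub: "K \<subseteq> join P (fst f)" if K: "heavy F K" for K
      proof (rule meets[OF K _ sp[OF J] join_upper1 join_upper2])
        show "K \<inter> fst f \<noteq> {0}" using no K by blast
      qed
      have "E \<subseteq> join P (fst f)"
        unfolding E_def by (rule join_least[OF sp[OF J] sub[OF L1] sub[OF L2]])
      then have "E = join P (fst f)" by (rule subspaces_of_dim_eqI[OF E J])
      with sub[OF L3] off show False by simp
    qed
    then obtain K where K: "heavy F K" "K \<inter> fst f = {0}" by blast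
    have PH: "P \<subseteq> snd f"
      using through[OF K(1)] heavy_subset_solid[OF F K(1) f(1) K(2)] by (rule subset_trans)
    show ?thesis
    proof (cases "M \<inter> fst f = {0}")
      case True
      then show ?thesis by (rule heavy_subset_solid[OF F M f(1)])
    next
      case False
      then show ?thesis by (rule meets[OF M _ sp[OF H(3)] PH H(4)])
    qed
  qed
  obtain S where S: "S \<in> points" "S \<subseteq> L3" "\<not> S \<subseteq> E"
  proof -
    obtain v where v: "v \<in> L3" "v \<notin> E" using off by blast
    then have "v \<noteq> 0" using vec.subspace_0[OF sp[OF E]] by blast
    then have 1: "vec.span {v} \<in> points"
      by (intro subspaces_of_dimI) (simp_all add: vec.dim_singleton)
    have 2: "vec.span {v} \<subseteq> L3"
      using v(1) by (intro vec.span_minimal sp[OF hl[OF L3]]) simp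
    have "\<not> vec.span {v} \<subseteq> E" using vec.span_base[of v "{v}"] v(2) by blast
    from that[OF 1 2 this] show thesis .
  qed
  define W where "W = join S E"
  have W: "W \<in> solids" unfolding W_def by (rule join_point_plane[OF S(1) E S(3)])
  have solid: "snd f = W" if f: "f \<in> F" "\<not> P \<subseteq> fst f" for f
  proof -
    note H = coclique_flag(3)[OF F f(1)]
    have "E \<subseteq> snd f"
      unfolding E_def by (rule join_least[OF sp[OF H] all_in[OF f L1] all_in[OF f L2]])
    then have "W \<subseteq> snd f"
      unfolding W_def using subset_trans[OF S(2) all_in[OF f L3]] by (intro join_least[OF sp[OF H]])
    from subspaces_of_dim_eqI[OF W H this] show ?thesis by simp
  qed
  obtain f0 where f0: "f0 \<in> F" "\<not> P \<subseteq> fst f0" using no_common[OF P(1)] by blast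
  have heavy_W: "M \<subseteq> W" if "heavy F M" for M
    using all_in[OF f0 that] solid[OF f0] by simp
  have PW: "P \<subseteq> W" using P(2) heavy_W[OF L1] by (rule subset_trans)
  define X1 where "X1 = {f \<in> F. P \<subseteq> fst f \<and> fst f \<subseteq> W}"
  define X2 where "X2 = {f \<in> F. \<not> P \<subseteq> fst f}"
  define X3 where "X3 = {f \<in> F. P \<subseteq> fst f \<and> \<not> fst f \<subseteq> W}"
  have "F = X1 \<union> X2 \<union> X3" unfolding X1_def X2_def X3_def by blast
  then have F_le: "card F \<le> card X1 + card X2 + card X3"
    using card_Un_le[of "X1 \<union> X2" X3] card_Un_le[of X1 X2] by simp
  have X2_snd: "snd f = W" "f \<in> F" if "f \<in> X2" for f
    using solid[of f] that by (simp_all add: X2_def)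
  have inj2: "inj_on fst X2"
    by (rule inj_onI) (simp add: X2_snd prod_eq_iff)
  have "card X1 \<le> card {L \<in> lines. P \<subseteq> L \<and> L \<subseteq> W} * (q ^ 2 + q + 1)"
  proof (rule card_flags_le)
    show "X1 \<subseteq> line_solid_flags" using coclique_flag(1)[OF F] unfolding X1_def by blast
    show "fst ` X1 \<subseteq> {L \<in> lines. P \<subseteq> L \<and> L \<subseteq> W}"
      using coclique_flag(2)[OF F] unfolding X1_def by auto
  qed simp
  then have X1_le: "card X1 \<le> (q ^ 2 + q + 1) * (q ^ 2 + q + 1)"
    by (simp only: card_lines_through(2)[OF P(1) PW W])
  show ?thesis
  proof (cases "X3 = {}")
    case True
    have "fst ` X2 \<subseteq> {L \<in> lines. L \<subseteq> W \<and> \<not> P \<subseteq> L}"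
    proof
      fix L assume "L \<in> fst ` X2"
      then obtain f where f: "f \<in> X2" "L = fst f" by (rule imageE)
      then show "L \<in> {L \<in> lines. L \<subseteq> W \<and> \<not> P \<subseteq> L}"
        using coclique_flag[OF F X2_snd(2)[OF f(1)]] X2_snd(1)[OF f(1)] by (simp add: X2_def)
    qed
    from card_le_inj_fst[OF inj2 this] have "card X2 \<le> q ^ 2 * (q ^ 2 + q + 1)"
      by (simp only: card_lines_in_solid_not_through_point[OF W P(1) PW])
    then have "card F \<le> (q ^ 2 + q + 1) * (q ^ 2 + q + 1) + q ^ 2 * (q ^ 2 + q + 1)"
      using F_le X1_le True by simp
    then show ?thesis by (simp add: algebra_simps)
  next
    case False
    then obtain g where g: "g \<in> X3" by blast
    then have gX: "g \<in> F" "P \<subseteq> fst g" "\<not> fst g \<subseteq> W" by (simp_all add: X3_def)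
    note G = coclique_flag[OF F gX(1)]
    have "snd g \<noteq> W" using G(4) gX(3) by blast
    then have E': "snd g \<inter> W \<in> planes" by (rule solids_Int[OF G(3) W])
    \<comment> \<open>A line of \<open>X2\<close> cannot meet \<open>fst g\<close>: a common point
      is different from \<open>P\<close>, lies in \<open>W\<close>, and would pull
      \<open>fst g\<close> into \<open>W\<close>. Since \<open>fst g\<close> is not in
      \<open>W\<close>, the coclique condition puts the line of \<open>X2\<close> into
      \<open>snd g\<close>.\<close>
    have "fst ` X2 \<subseteq> {L \<in> lines. L \<subseteq> snd g \<inter> W}"
    proof
      fix L assume "L \<in> fst ` X2"
      then obtain f where f: "f \<in> X2" "L = fst f" by (rule imageE)
      note f' = X2_snd[OF f(1)]
      note Ff = coclique_flag[OF F f'(2)]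
      have LW: "fst f \<subseteq> W" using Ff(4) f'(1) by simp
      have "fst f \<inter> fst g = {0}"
      proof (rule ccontr)
        assume "fst f \<inter> fst g \<noteq> {0}"
        then obtain Q where Q: "Q \<in> points" "Q \<subseteq> fst f" "Q \<subseteq> fst g"
          by (rule common_point[OF Ff(2) G(2)])
        have "Q \<noteq> P" using Q(2) f(1) by (auto simp: X2_def)
        from line_subset[OF Q(1) P(1) this G(2) Q(3) gX(2) sp[OF W] subset_trans[OF Q(2) LW] PW] gX(3)
        show False by simp
      qed
      then have "fst f \<subseteq> snd g"
        using cocliqueD[OF F f'(2) gX(1)] f'(1) gX(3) by simp
      with LW Ff(2) f(2) show "L \<in> {L \<in> lines. L \<subseteq> snd g \<inter> W}" by simp
    qed
    from card_le_inj_fst[OF inj2 this] have X2_le: "card X2 \<le> q ^ 2 + q + 1"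
      by (simp only: card_lines_in_plane[OF E'])
    have inj3: "inj_on fst X3"
    proof (rule inj_on_subset[OF inj_on_fst_light[of F]])
      show "X3 \<subseteq> {f \<in> F. \<not> heavy F (fst f)}" using heavy_W unfolding X3_def by blast
    qed
    have "fst ` X3 \<subseteq> {L \<in> lines. P \<subseteq> L}"
      using coclique_flag(2)[OF F] unfolding X3_def by auto
    from card_le_inj_fst[OF inj3 this] have "card X3 \<le> q ^ 3 + q ^ 2 + q + 1"
      by (simp only: card_lines_through_5[OF P(1)])
    with F_le X1_le X2_le have "card F \<le> (q ^ 2 + q + 1) * (q ^ 2 + q + 1) + (q ^ 2 + q + 1)
        + (q ^ 3 + q ^ 2 + q + 1)"
      by linarith
    also have "\<dots> \<le> (q ^ 2 + q + 1) * (2 * q ^ 2 + q + 1)"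
    proof -
      have "2 * q \<le> q * q" "2 * (q * q) \<le> q * (q * q)" "2 * (q * (q * q)) \<le> q * (q * (q * q))"
        using q_ge_2 by simp_all
      then show ?thesis using q_ge_2 by (simp add: algebra_simps eval_nat_numeral)
    qed
    finally show ?thesis .
  qed
qed

theorem card_coclique_le:
  fixes F :: "(('a ^ 5) set \<times> ('a ^ 5) set) set"
  assumes F: "coclique F" and no_common: "\<And>P. P \<in> points \<Longrightarrow> \<exists>f\<in>F. \<not> P \<subseteq> fst f"
  shows "card F \<le> (q ^ 2 + q + 1) * (2 * q ^ 2 + q + 1)"
proof (cases "\<exists>L1 L2. heavy F L1 \<and> heavy F L2 \<and> L1 \<noteq> L2")
  case False
  show ?thesis
  proof (cases "\<exists>L. heavy F L")
    case True
    then obtain L0 where "heavy F L0" ..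
    with False show ?thesis by (intro card_le_if_single_heavy[OF F, of L0]) blast
  next
    case no: False
    then show ?thesis by (intro card_le_if_single_heavy[OF F]) blast
  qed
next
  case True
  then obtain L1 L2 where L: "heavy F L1" "heavy F L2" "L1 \<noteq> L2" by blast
  show ?thesis
  proof (cases "\<forall>L. heavy F L \<longrightarrow> L \<subseteq> join L1 L2")
    case True
    have "join L1 L2 \<in> planes"
      by (rule meeting_point[OF heavy_line[OF F L(1)] heavy_line[OF F L(2)] L(3)
        heavy_lines_meet[OF F L(1,2)]])
    then show ?thesis
      by (rule card_le_if_heavy_coplanar[OF F L]) (use True in blast)
  next
    case False
    then obtain L3 where "heavy F L3" "\<not> L3 \<subseteq> join L1 L2" by blast
    then show ?thesis by (rule card_le_if_heavy_not_coplanar[OF F L _ _ no_common])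
  qed
qed

end

section \<open>Point sets missing few lines\<close>

text \<open>Every fibre of \<open>j\<close> over its image has at least two elements. In the
  application, \<open>j\<close> projects the aligned points from a point outside
  \<open>M\<close>.\<close>

lemma card_image_no_singleton_fibres:
  assumes "finite B" and "\<And>x. x \<in> B \<Longrightarrow> \<exists>y\<in>B. y \<noteq> x \<and> j y = j x"
  shows "2 * card (j ` B) \<le> card B"
proof -
  have "2 \<le> card {x \<in> B. j x = L}" if L: "L \<in> j ` B" for L
  proof -
    obtain x where x: "x \<in> B" "L = j x" using L by blast
    obtain y where y: "y \<in> B" "y \<noteq> x" "j y = j x" using assms(2)[OF x(1)] by blast
    have "{x, y} \<subseteq> {x \<in> B. j x = L}" using x y by auto
    then have "card {x, y} \<le> card {x \<in> B. j x = L}" using assms(1) by (intro card_mono) auto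
    then show ?thesis using y(2) by simp
  qed
  then have "of_nat (card (j ` B)) * 2 \<le> (\<Sum>L\<in>j ` B. card {x \<in> B. j x = L})"
    by (intro sum_bounded_below) simp
  also have "\<dots> = card B"
    using sum.image_gen[OF assms(1), of "\<lambda>_. 1::nat" j] by simp
  finally show ?thesis by simp
qed

text \<open>\<open>X\<close> is a disjoint union of cosets of \<open>K\<close>.\<close>

lemma card_dvd_translation_invariant:
  fixes K X :: "('a::{field,finite} ^ 'n) set"
  assumes K: "vec.subspace K" and X: "\<And>u v. u \<in> K \<Longrightarrow> v \<in> X \<Longrightarrow> u + v \<in> X"
  shows "card K dvd card X"
proof -
  let ?c = "\<lambda>v. (\<lambda>u. u + v) ` K"
  have "X = \<Union> (?c ` X)"
  proof (intro equalityI subsetI)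
    fix v assume "v \<in> X"
    moreover have "v \<in> ?c v" using vec.subspace_0[OF K] by (intro image_eqI[of _ _ 0]) simp_all
    ultimately show "v \<in> \<Union> (?c ` X)" by (rule UN_I)
  next
    fix v assume "v \<in> \<Union> (?c ` X)"
    then obtain w u where "w \<in> X" "u \<in> K" "v = u + w" by blast
    then show "v \<in> X" using X by simp
  qed
  moreover have "card K dvd card (\<Union> (?c ` X))"
  proof (rule dvd_partition)
    show "\<forall>c\<in>?c ` X. card K dvd card c"
      by (auto simp: card_image)
    show "\<forall>c1\<in>?c ` X. \<forall>c2\<in>?c ` X. c1 \<noteq> c2 \<longrightarrow> c1 \<inter> c2 = {}"
    proof (intro ballI impI, rule ccontr)
      fix c1 c2 assume "c1 \<in> ?c ` X" "c2 \<in> ?c ` X" and ne: "c1 \<noteq> c2" and "c1 \<inter> c2 \<noteq> {}"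
      then obtain v w a b where c: "c1 = ?c v" "c2 = ?c w" and ab: "a \<in> K" "b \<in> K" "a + v = b + w"
        by blast
      have sub: "?c x \<subseteq> ?c y" if "x = k + y" "k \<in> K" for x y k
      proof
        fix z assume "z \<in> ?c x"
        then obtain u where "u \<in> K" "z = u + x" by blast
        then have "z = (u + k) + y" "u + k \<in> K"
          using that vec.subspace_add[OF K] by (simp_all add: add.assoc)
        then show "z \<in> ?c y" by (rule image_eqI)
      qed
      have "v = (b - a) + w" using ab(3) by (simp add: algebra_simps)
      then have 1: "?c v \<subseteq> ?c w" by (rule sub[OF _ vec.subspace_diff[OF K ab(2,1)]])
      have "w = (a - b) + v" using ab(3) by (simp add: algebra_simps)
      then have "?c w \<subseteq> ?c v" by (rule sub[OF _ vec.subspace_diff[OF K ab(1,2)]])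
      with 1 c ne show False by simp
    qed
  qed simp
  ultimately show ?thesis by simp
qed

context gf_space
begin

text \<open>Different points share only the zero vector, and each has q - 1 nonzero vectors.\<close>

lemma card_Union_points:
  fixes M :: "('a ^ 'n) set set"
  assumes M: "M \<subseteq> points" "M \<noteq> {}"
  shows "card (\<Union> M) = 1 + (q - 1) * card M"
proof -
  have zero: "0 \<in> P" if "P \<in> M" for P
    using vec.subspace_0 subspaces_of_dimD(1) M(1) that by blast
  have "card (\<Union>P\<in>M. P - {0}) = (\<Sum>P\<in>M. card (P - {0}))"
  proof (rule card_UN_disjoint)
    show "\<forall>P\<in>M. \<forall>Q\<in>M. P \<noteq> Q \<longrightarrow> (P - {0}) \<inter> (Q - {0}) = {}"
    proof (intro ballI impI)
      fix P Q assume PQ: "P \<in> M" "Q \<in> M" "P \<noteq> Q"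
      then have "P \<in> points" "Q \<in> points" using M(1) by (simp_all add: subset_iff)
      moreover from this have "\<not> P \<subseteq> Q" using points_subset_eq PQ(3) by blast
      ultimately have "P \<inter> Q = {0}" by (intro point_Int subspaces_of_dimD(1))
      then show "(P - {0}) \<inter> (Q - {0}) = {}" by blast
    qed
  qed simp_all
  also have "\<dots> = (\<Sum>P\<in>M. q - 1)"
  proof (rule sum.cong)
    fix P assume P: "P \<in> M"
    then have "P \<in> points" using M(1) by (simp add: subset_iff)
    then have "card P = q" using card_subspace[of P 1] by simp
    then show "card (P - {0}) = q - 1" using zero[OF P] by (simp add: card_Diff_singleton)
  qed simp
  finally have eq: "card (\<Union>P\<in>M. P - {0}) = (q - 1) * card M" by simp
  have ins: "\<Union> M = insert 0 (\<Union>P\<in>M. P - {0})" using zero M(2) by blast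
  have "0 \<notin> (\<Union>P\<in>M. P - {0})" by blast
  then have "card (insert 0 (\<Union>P\<in>M. P - {0})) = Suc (card (\<Union>P\<in>M. P - {0}))"
    by (intro card_insert_disjoint finite)
  then have "card (\<Union> M) = Suc (card (\<Union>P\<in>M. P - {0}))" unfolding ins[symmetric] .
  then show ?thesis by (simp only: eq Suc_eq_plus1_left)
qed

end

text \<open>For \<open>R\<close> outside \<open>M\<close>, these are the points in the non-singleton
  fibres of the projection of \<open>M\<close> from \<open>R\<close>. Their number improves the
  count of lines through \<open>R\<close> that miss \<open>M\<close>, while a point that is never
  aligned acts on the union of \<open>M\<close> by translations.\<close>

definition aligned :: "('a::field ^ 'n) set set \<Rightarrow> ('a ^ 'n) set \<Rightarrow> ('a ^ 'n) set set" where
  "aligned M R = {P \<in> M. \<exists>Q\<in>M. Q \<noteq> P \<and> Q \<subseteq> join R P}"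

text \<open>If v lies in another point \<open>Q\<close> of \<open>M\<close> and u + v is nonzero,
  then u + v spans a point \<open>R\<close> on the line of \<open>P\<close> and \<open>Q\<close>.
  Were \<open>R\<close> outside \<open>M\<close>, then \<open>Q\<close> would witness that
  \<open>P\<close> is aligned with respect to \<open>R\<close>.\<close>

lemma translation_if_not_aligned:
  fixes M :: "('a::field ^ 'n) set set"
  assumes M: "M \<subseteq> points" and P: "P \<in> M"
    and na: "\<And>R. R \<in> points \<Longrightarrow> R \<notin> M \<Longrightarrow> P \<notin> aligned M R"
    and u: "u \<in> P" and v: "v \<in> \<Union> M"
  shows "u + v \<in> \<Union> M"
proof -
  obtain Q where Q: "Q \<in> M" "v \<in> Q" using v by blast
  have pt: "P \<in> points" "Q \<in> points" using M P Q by (simp_all add: subset_iff)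
  note sp = subspaces_of_dimD(1)
  show ?thesis
  proof (cases "P = Q \<or> u + v = 0")
    case True
    then have "u + v \<in> P"
      using u Q(2) vec.subspace_add[OF sp[OF pt(1)]] vec.subspace_0[OF sp[OF pt(1)]] by metis
    with P show ?thesis by (rule UnionI)
  next
    case False
    define R where "R = vec.span {u + v}"
    have R: "R \<in> points"
      unfolding R_def using False by (intro subspaces_of_dimI) (simp_all add: vec.dim_singleton)
    have uvR: "u + v \<in> R" unfolding R_def by (rule vec.span_base) simp
    have "R \<in> M"
    proof (rule ccontr)
      assume RM: "R \<notin> M"
      have J: "join P Q \<in> lines" using False by (intro join_points[OF pt]) simp
      have "u + v \<in> join P Q"
        by (rule vec.subspace_add[OF subspace_join subsetD[OF join_upper1 u] subsetD[OF join_upper2 Q(2)]])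
      then have "R \<subseteq> join P Q" unfolding R_def by (intro vec.span_minimal subspace_join) simp
      moreover have "R \<noteq> P" using RM P by blast
      ultimately have "join P Q = join R P"
        by (intro line_eq_join[OF R pt(1) _ J]) (simp_all add: join_upper1)
      then have "Q \<subseteq> join R P" using join_upper2[of Q P] by simp
      moreover have "Q \<noteq> P" using False by blast
      ultimately have "P \<in> aligned M R" unfolding aligned_def using P Q(1) by blast
      with na[OF R RM] show False by simp
    qed
    with uvR show ?thesis by (rule UnionI[rotated])
  qed
qed

section \<open>Counting lines that miss a point set\<close>

context gf_space
begin

text \<open>The lines through \<open>R\<close> that hit \<open>M\<close> are the joins of
  \<open>R\<close> with points of \<open>M\<close>. Each join with an aligned point arises at least
  twice, so with a aligned points at most card M - a/2 lines are hit. Everything is doubled to avoid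
  the fraction.\<close>

lemma card_missed_lines_through:
  fixes M :: "('a ^ 5) set set"
  assumes M: "M \<subseteq> points" and R: "R \<in> points" "R \<notin> M"
  shows "2 * (q ^ 3 + q ^ 2 + q + 1) + card (aligned M R)
    \<le> 2 * card {L \<in> lines. R \<subseteq> L \<and> (\<forall>P\<in>M. \<not> P \<subseteq> L)} + 2 * card M"
proof -
  let ?A = "aligned M R" and ?miss = "{L \<in> lines. R \<subseteq> L \<and> (\<forall>P\<in>M. \<not> P \<subseteq> L)}"
  have ne: "R \<noteq> P" if "P \<in> M" for P using that R(2) by blast
  have pt: "P \<in> points" if "P \<in> M" for P using that M by (rule subsetD[rotated])
  have A: "?A \<subseteq> M" unfolding aligned_def by blast
  have line: "join R P \<in> lines" if "P \<in> M" for P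
    by (rule join_points[OF R(1) pt[OF that] ne[OF that]])
  have "{L \<in> lines. R \<subseteq> L} \<subseteq> ?miss \<union> join R ` M"
  proof
    fix L assume L: "L \<in> {L \<in> lines. R \<subseteq> L}"
    show "L \<in> ?miss \<union> join R ` M"
    proof (cases "\<exists>P\<in>M. P \<subseteq> L")
      case True
      then obtain P where P: "P \<in> M" "P \<subseteq> L" by blast
      have "L = join R P" using L by (intro line_eq_join[OF R(1) pt[OF P(1)] ne[OF P(1)] _ _ P(2)]) simp_all
      with P(1) show ?thesis by blast
    next
      case False
      with L show ?thesis by simp
    qed
  qed
  then have "card {L \<in> lines. R \<subseteq> L} \<le> card (?miss \<union> join R ` M)" by (intro card_mono) simp_all
  also have "\<dots> \<le> card ?miss + card (join R ` M)" by (rule card_Un_le)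
  finally have 1: "q ^ 3 + q ^ 2 + q + 1 \<le> card ?miss + card (join R ` M)"
    by (simp only: card_lines_through_5[OF R(1)])
  have "join R ` M = join R ` (M - ?A) \<union> join R ` ?A" using A by blast
  then have "card (join R ` M) \<le> card (join R ` (M - ?A)) + card (join R ` ?A)"
    by (simp only: card_Un_le)
  also have "card (join R ` (M - ?A)) \<le> card (M - ?A)" by (rule card_image_le) simp
  also have "card (M - ?A) = card M - card ?A" using A by (intro card_Diff_subset) simp_all
  finally have 2: "card (join R ` M) \<le> card M - card ?A + card (join R ` ?A)" by simp
  have "card ?A \<le> card M" using A by (intro card_mono) simp_all
  \<comment> \<open>Writing \<open>card M\<close> as a sum removes the truncated subtraction in the
    previous bound.\<close>
  then obtain d where 3: "card M = card ?A + d" using le_Suc_ex by blast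
  have "2 * card (join R ` ?A) \<le> card ?A"
  proof (rule card_image_no_singleton_fibres)
    fix P assume "P \<in> ?A"
    then obtain Q where P: "P \<in> M" and Q: "Q \<in> M" "Q \<noteq> P" "Q \<subseteq> join R P"
      unfolding aligned_def by blast
    have eq: "join R P = join R Q"
      by (rule line_eq_join[OF R(1) pt[OF Q(1)] ne[OF Q(1)] line[OF P] join_upper1 Q(3)])
    have "P \<subseteq> join R Q" using join_upper2[of P R] by (simp only: eq)
    then have "Q \<in> ?A" unfolding aligned_def using P Q by blast
    with Q(2) eq show "\<exists>y\<in>?A. y \<noteq> P \<and> join R y = join R P" by metis
  qed simp
  moreover have "card (join R ` M) \<le> d + card (join R ` ?A)" using 2 3 by simp
  moreover have "2 * t + a \<le> 2 * b + 2 * m"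
    if "2 * i \<le> a" "j \<le> d + i" "t \<le> b + j" "m = a + d" for t a b m i j :: nat
    using that by linarith
  ultimately show ?thesis using 1 3 by blast
qed

text \<open>Counting the pairs of a point outside \<open>M\<close> and a line through it that misses \<open>M\<close>.\<close>
lemma card_missed_lines:
  fixes M :: "('a ^ 5) set set"
  assumes M: "M \<subseteq> points" and x: "card M + x = q ^ 3 + q ^ 2 + q + 1"
  shows "2 * x * (q ^ 4 + x) + (\<Sum>R\<in>points - M. card (aligned M R))
    \<le> 2 * (q + 1) * card {L \<in> lines. \<forall>P\<in>M. \<not> P \<subseteq> L}"
proof -
  let ?T = "{L \<in> lines. \<forall>P\<in>M. \<not> P \<subseteq> L}"
  have "card (points :: ('a ^ 5) set set) = q ^ 4 + q ^ 3 + q ^ 2 + q + 1"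
    using card_points_numeral(4)[OF UNIV_dim_5] by simp
  moreover have "card (points - M) = card (points :: ('a ^ 5) set set) - card M"
    using M by (intro card_Diff_subset) simp_all
  ultimately have card_out: "card (points - M) = q ^ 4 + x" using x by linarith
  have "(\<Sum>R\<in>points - M. card {L \<in> ?T. R \<subseteq> L}) = (q + 1) * card ?T"
  proof (rule sum_multicount)
    show "\<forall>L\<in>?T. card {R \<in> points - M. R \<subseteq> L} = q + 1"
    proof
      fix L assume L: "L \<in> ?T"
      then have "{R \<in> points - M. R \<subseteq> L} = {R \<in> points. R \<subseteq> L}" by blast
      then show "card {R \<in> points - M. R \<subseteq> L} = q + 1"
        using L card_points_numeral(1)[of L] by simp
    qed
  qed simp_all
  moreover have "2 * x + card (aligned M R) \<le> 2 * card {L \<in> ?T. R \<subseteq> L}" if "R \<in> points - M" for R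
  proof -
    have "{L \<in> ?T. R \<subseteq> L} = {L \<in> lines. R \<subseteq> L \<and> (\<forall>P\<in>M. \<not> P \<subseteq> L)}" by blast
    then show ?thesis using card_missed_lines_through[OF M, of R] that x by simp
  qed
  then have "(\<Sum>R\<in>points - M. 2 * x + card (aligned M R)) \<le> (\<Sum>R\<in>points - M. 2 * card {L \<in> ?T. R \<subseteq> L})"
    by (rule sum_mono)
  ultimately have "card (points - M) * (2 * x) + (\<Sum>R\<in>points - M. card (aligned M R))
      \<le> 2 * ((q + 1) * card ?T)"
    by (simp only: sum.distrib sum_constant of_nat_id flip: sum_distrib_left)
  then show ?thesis unfolding card_out by (simp only: ac_simps)
qed

text \<open>Without missed lines, the count leaves no aligned points with respect to points outside
  \<open>M\<close>. So the union of \<open>M\<close> is closed under addition and is a subspace,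
  with 1 + (q - 1)(q^3 + q^2 + q + 1) = q^4 vectors.\<close>

lemma blocking_set_solid:
  fixes M :: "('a ^ 5) set set"
  assumes M: "M \<subseteq> points" and card_M: "card M = q ^ 3 + q ^ 2 + q + 1"
    and block: "{L \<in> lines. \<forall>P\<in>M. \<not> P \<subseteq> L} = {}"
  shows "\<exists>H\<in>solids. M = {P \<in> points. P \<subseteq> H}"
proof -
  \<comment> \<open>This is \<open>card_missed_lines\<close> with x = 0; the right side is zero by
    \<open>block\<close>.\<close>
  have "2 * 0 * (q ^ 4 + 0) + (\<Sum>R\<in>points - M. card (aligned M R))
      \<le> 2 * (q + 1) * card {L \<in> lines. \<forall>P\<in>M. \<not> P \<subseteq> L}"
    by (rule card_missed_lines[OF M]) (simp add: card_M)
  then have "(\<Sum>R\<in>points - M. card (aligned M R)) = 0" unfolding block by simp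
  then have "aligned M R = {}" if "R \<in> points" "R \<notin> M" for R
    using that by (simp add: sum_eq_0_iff)
  then have na: "P \<notin> aligned M R" if "R \<in> points" "R \<notin> M" for P R
    using that by simp
  have ne: "M \<noteq> {}" using card_M by auto
  have sp: "vec.subspace P" if "P \<in> M" for P
    using subspaces_of_dimD(1) subsetD[OF M that] .
  have sub: "vec.subspace (\<Union> M)"
  proof (rule vec.subspaceI)
    from ne obtain P where "P \<in> M" by blast
    then show "0 \<in> \<Union> M" using vec.subspace_0[OF sp] by (rule_tac UnionI)
  next
    fix u v assume "u \<in> \<Union> M" and v: "v \<in> \<Union> M"
    then obtain P where "P \<in> M" "u \<in> P" by blast
    then show "u + v \<in> \<Union> M" using v by (intro translation_if_not_aligned[OF M _ na])
  next
    fix k u assume "u \<in> \<Union> M"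
    then obtain P where "P \<in> M" "u \<in> P" by blast
    then show "k *s u \<in> \<Union> M" using vec.subspace_scale[OF sp] by (rule_tac UnionI)
  qed
  have "card (\<Union> M) = 1 + (q - 1) * (q ^ 3 + q ^ 2 + q + 1)"
    using card_Union_points[OF M ne] card_M by simp
  also have "\<dots> = q ^ 4"
  proof -
    obtain r where "q = Suc r" using q_ge_2 by (cases q) auto
    then show ?thesis by (simp add: algebra_simps eval_nat_numeral)
  qed
  finally have "q ^ vec.dim (\<Union> M) = q ^ 4"
    using card_subspace[OF subspaces_of_dimI[OF sub refl]] by simp
  then have "vec.dim (\<Union> M) = 4" using q_ge_2 by simp
  with sub have H: "\<Union> M \<in> solids" by (rule subspaces_of_dimI)
  \<comment> \<open>A nonzero vector of a point inside the union lies in some member of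
    \<open>M\<close>, which must be that point.\<close>
  moreover have "M = {P \<in> points. P \<subseteq> \<Union> M}"
  proof (intro equalityI subsetI)
    fix P assume P: "P \<in> {P \<in> points. P \<subseteq> \<Union> M}"
    then have pt: "P \<in> points" by simp
    have "P \<inter> \<Union> M \<noteq> {0}" using Int_nonzero[OF pt, of P "\<Union> M"] P by simp
    then obtain v where v: "v \<in> P" "v \<noteq> 0"
      using vec.subspace_0[OF subspaces_of_dimD(1)[OF pt]] vec.subspace_0[OF sub] by blast
    then obtain Q where Q: "Q \<in> M" "v \<in> Q" using P by blast
    have "P \<inter> Q \<noteq> {0}" using v Q by blast
    then have "P \<subseteq> Q" using point_Int[OF pt sp[OF Q(1)]] by blast
    then have "P = Q" using points_subset_eq[OF pt] subsetD[OF M Q(1)] by blast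
    with Q(1) show "P \<in> M" by simp
  next
    fix P assume "P \<in> M"
    then show "P \<in> {P \<in> points. P \<subseteq> \<Union> M}" using subsetD[OF M] by blast
  qed
  ultimately show ?thesis by blast
qed

text \<open>For \<open>q = 3\<close> the count of the missed lines is too weak if \<open>M\<close> lacks at most seven points. But
  then two points of \<open>M\<close> are aligned with respect to no point outside \<open>M\<close>, and the vectors in \<open>M\<close> are
  invariant under translation by the nine vectors on their line.\<close>
lemma few_missed_lines_solid:
  fixes M :: "('a ^ 5) set set"
  assumes q: "3 \<le> q" and M: "M \<subseteq> points" and x: "card M + x = q ^ 3 + q ^ 2 + q + 1"
    and missed: "card {L \<in> lines. \<forall>P\<in>M. \<not> P \<subseteq> L} \<le> (2 * q ^ 2 + q + 1) * x"
  shows "\<exists>H\<in>solids. M = {P \<in> points. P \<subseteq> H}"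
proof (cases "x = 0")
  case True
  with missed have "{L \<in> lines. \<forall>P\<in>M. \<not> P \<subseteq> L} = {}" by simp
  then show ?thesis using x True by (intro blocking_set_solid[OF M]) simp_all
next
  case False
  let ?b = "\<Sum>R\<in>points - M. card (aligned M R)"
  have "2 * x * (q ^ 4 + x) + ?b \<le> 2 * (q + 1) * ((2 * q ^ 2 + q + 1) * x)"
    using card_missed_lines[OF M x] mult_le_mono2[OF missed, of "2 * (q + 1)"] by (rule order_trans)
  also have "\<dots> = 2 * x * ((q + 1) * (2 * q ^ 2 + q + 1))" by (simp only: ac_simps)
  finally have le: "2 * x * (q ^ 4 + x) + ?b \<le> 2 * x * ((q + 1) * (2 * q ^ 2 + q + 1))" .
  then have "2 * x * (q ^ 4 + x) \<le> 2 * x * ((q + 1) * (2 * q ^ 2 + q + 1))" by linarith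
  then have le': "q ^ 4 + x \<le> (q + 1) * (2 * q ^ 2 + q + 1)"
    by (rule nat_mult_le_cancel1[THEN iffD1, rotated]) (use False in simp)
  have "q = 3"
  \<comment> \<open>For q at least 4, already q^4 \<ge> 4 q^3 exceeds 2 q^3 + 3 q^2 + 2 q + 1, the
    expansion of the right side of \<open>le'\<close>.\<close>
  proof (rule ccontr)
    assume "q \<noteq> 3"
    then have "4 * q \<le> q * q" "4 * (q * q) \<le> q * (q * q)" "4 * (q * (q * q)) \<le> q * (q * (q * q))"
      using q by simp_all
    moreover have "q * (q * (q * q)) + x \<le> 2 * (q * (q * q)) + 3 * (q * q) + 2 * q + 1"
      using le' by (simp add: algebra_simps eval_nat_numeral)
    ultimately show False using False q by linarith
  qed
  then have x_le: "x \<le> 7" and m: "card M + x = 40" using le' x by simp_all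
  \<comment> \<open>For q = 3 the inequality \<open>le\<close> reads 2 x (81 + x) + ?b \<le> 2 x *
    88, so ?b is at most 2 x (7 - x), whose maximum 24 is attained at x = 3 and x = 4.\<close>
  have b: "?b \<le> 24"
  proof -
    have "2 * x * (81 + x) + ?b \<le> 2 * x * 88" using le \<open>q = 3\<close> by simp
    moreover have "2 * x * 88 \<le> 2 * x * (81 + x) + 24"
    proof -
      have "x \<in> {1, 2, 3, 4, 5, 6, 7}" using False x_le by auto
      then show ?thesis by auto
    qed
    ultimately show ?thesis by linarith
  qed
  \<comment> \<open>These points of \<open>M\<close> are aligned with respect to no point outside
    \<open>M\<close>. As \<open>M\<close> has at least 33 points and at most 24 are removed, two
    such points exist.\<close>
  define G where "G = M - (\<Union>R\<in>points - M. aligned M R)"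
  have "card M - card (\<Union>R\<in>points - M. aligned M R) \<le> card G"
    unfolding G_def by (intro diff_card_le_card_Diff) simp
  moreover have "card (\<Union>R\<in>points - M. aligned M R) \<le> ?b" by (rule card_UN_le) simp
  ultimately have "2 \<le> card G" using b m x_le by linarith
  then obtain P Q where PQ: "P \<in> G" "Q \<in> G" "P \<noteq> Q"
    by (metis card_2_iff' card_le_Suc0_iff_eq finite numeral_2_eq_2 not_less_eq_eq)
  have PM: "P \<in> M" "Q \<in> M" using PQ by (simp_all add: G_def)
  have pt: "P \<in> points" "Q \<in> points" using PM subsetD[OF M] by simp_all
  have na: "S \<notin> aligned M R" if "S \<in> G" "R \<in> points" "R \<notin> M" for S R
    using that unfolding G_def by blast
  have "card (join P Q) dvd card (\<Union> M)"
  proof (rule card_dvd_translation_invariant[OF subspace_join])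
    fix w v assume "w \<in> join P Q" and v: "v \<in> \<Union> M"
    then obtain a b where ab: "w = a + b" "a \<in> P" "b \<in> Q"
      unfolding join_eq_sums[OF subspaces_of_dimD(1)[OF pt(1)] subspaces_of_dimD(1)[OF pt(2)]] by blast
    have "b + v \<in> \<Union> M"
      by (rule translation_if_not_aligned[OF M PM(2) na[OF PQ(2)] ab(3) v])
    then have "a + (b + v) \<in> \<Union> M"
      by (intro translation_if_not_aligned[OF M PM(1) na[OF PQ(1)] ab(2)])
    then show "w + v \<in> \<Union> M" by (simp add: ab(1) add.assoc)
  qed
  moreover have "card (join P Q) = 9"
    using card_subspace[OF join_points[OF pt PQ(3)]] \<open>q = 3\<close> by simp
  moreover have "card (\<Union> M) = 1 + 2 * card M"
    using card_Union_points[OF M] PM(1) \<open>q = 3\<close> by auto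
  \<comment> \<open>The union of \<open>M\<close> has 1 + 2 (40 - x) = 81 - 2 x vectors, and 9 does
    not divide this for x from 1 to 7.\<close>
  ultimately have "9 dvd 1 + 2 * card M" by simp
  moreover have "card M = 40 - x" using m by simp
  ultimately have "9 dvd 1 + 2 * (40 - x)" by simp
  moreover have "x \<in> {1, 2, 3, 4, 5, 6, 7}" using False x_le by auto
  ultimately have False by auto
  then show ?thesis ..
qed

end

section \<open>Colorings\<close>

context gf_space
begin

lemma card_flags_over_lines:
  fixes T :: "('a ^ 5) set set"
  assumes "T \<subseteq> lines"
  shows "card {f \<in> line_solid_flags. fst f \<in> T} = card T * (q ^ 2 + q + 1)"
proof -
  have "{f \<in> line_solid_flags. fst f \<in> T} = (SIGMA L:T. {H \<in> solids. L \<subseteq> H})"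
    using assms by (auto simp: line_solid_flags_def)
  also have "card \<dots> = (\<Sum>L\<in>T. card {H \<in> solids. L \<subseteq> H})"
    by (rule card_SigmaI) simp_all
  also have "\<dots> = (\<Sum>L\<in>T. q ^ 2 + q + 1)"
    using assms by (intro sum.cong card_solids_through_line_5) auto
  finally show ?thesis by simp
qed

lemma coclique_cover:
  fixes F :: "nat \<Rightarrow> (('a ^ 5) set \<times> ('a ^ 5) set) set"
  assumes q: "3 \<le> q" and F: "\<And>i. coclique (F i)"
    and cover: "line_solid_flags \<subseteq> (\<Union>i<q ^ 3 + q ^ 2 + q + 1. F i)"
  shows "\<exists>H\<in>solids. \<exists>t. bij_betw t {..<q ^ 3 + q ^ 2 + q + 1} {P \<in> points. P \<subseteq> H} \<and>
    (\<forall>i<q ^ 3 + q ^ 2 + q + 1. \<forall>f\<in>F i. t i \<subseteq> fst f)"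
proof -
  define N where "N = q ^ 3 + q ^ 2 + q + 1"
  \<comment> \<open>An empty class is good as well; then any point may be chosen for it.\<close>
  define good where "good = {i. i < N \<and> (\<exists>P\<in>points. \<forall>f\<in>F i. P \<subseteq> fst f)}"
  have "\<forall>i\<in>good. \<exists>P. P \<in> points \<and> (\<forall>f\<in>F i. P \<subseteq> fst f)" unfolding good_def by blast
  then obtain t where t: "\<forall>i\<in>good. t i \<in> points \<and> (\<forall>f\<in>F i. t i \<subseteq> fst f)"
    unfolding bchoice_iff by (elim exE)
  have good_N: "good \<subseteq> {..<N}" unfolding good_def by blast
  then have fin: "finite good" by (rule finite_subset) simp
  have card_good: "card good \<le> N" using card_mono[OF _ good_N] by simp
  define M where "M = t ` good"
  have M: "M \<subseteq> points" unfolding M_def using t by blast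
  have M_good: "card M \<le> card good" unfolding M_def by (rule card_image_le[OF fin])
  define T where "T = {L \<in> lines. \<forall>P\<in>M. \<not> P \<subseteq> L}"
  have T: "T \<subseteq> lines" unfolding T_def by blast
  have "{f \<in> line_solid_flags. fst f \<in> T} \<subseteq> (\<Union>i\<in>{..<N} - good. F i)"
  proof
    fix f assume f: "f \<in> {f \<in> line_solid_flags. fst f \<in> T}"
    then obtain i where i: "i < N" "f \<in> F i" using cover unfolding N_def by blast
    have "i \<notin> good"
    proof
      assume good: "i \<in> good"
      then have "t i \<subseteq> fst f" "t i \<in> M" using t i(2) unfolding M_def by blast+
      with f show False by (simp add: T_def)
    qed
    with i show "f \<in> (\<Union>i\<in>{..<N} - good. F i)" by blast
  qed
  then have "card {f \<in> line_solid_flags. fst f \<in> T}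
      \<le> card ({..<N} - good) * ((q ^ 2 + q + 1) * (2 * q ^ 2 + q + 1))"
  proof (rule card_le_UN[rotated 2])
    fix i assume "i \<in> {..<N} - good"
    then have "\<And>P. P \<in> points \<Longrightarrow> \<exists>f\<in>F i. \<not> P \<subseteq> fst f" unfolding good_def by blast
    then show "card (F i) \<le> (q ^ 2 + q + 1) * (2 * q ^ 2 + q + 1)"
      by (rule card_coclique_le[OF F])
  qed simp_all
  also have "card ({..<N} - good) = N - card good"
    using good_N by (simp add: card_Diff_subset[OF fin])
  \<comment> \<open>The choice \<open>t\<close> may repeat points, so \<open>M\<close> can have
    fewer elements than \<open>good\<close>. The weaker bound in terms of \<open>card M\<close> is
    the one that \<open>few_missed_lines_solid\<close> takes.\<close>
  also have "(N - card good) * ((q ^ 2 + q + 1) * (2 * q ^ 2 + q + 1))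
      \<le> (N - card M) * ((q ^ 2 + q + 1) * (2 * q ^ 2 + q + 1))"
    using M_good by (intro mult_le_mono1 diff_le_mono2)
  also have "\<dots> = (2 * q ^ 2 + q + 1) * (N - card M) * (q ^ 2 + q + 1)"
    by (simp only: ac_simps)
  finally have "card T * (q ^ 2 + q + 1) \<le> (2 * q ^ 2 + q + 1) * (N - card M) * (q ^ 2 + q + 1)"
    by (simp only: card_flags_over_lines[OF T])
  then have "card T \<le> (2 * q ^ 2 + q + 1) * (N - card M)" by (simp only: mult_le_cancel2)
  moreover have "card M + (N - card M) = q ^ 3 + q ^ 2 + q + 1"
    using M_good card_good by (simp add: N_def)
  ultimately have "\<exists>H\<in>solids. M = {P \<in> points. P \<subseteq> H}"
    unfolding T_def by (intro few_missed_lines_solid[OF q M])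
  then obtain H where H: "H \<in> solids" "M = {P \<in> points. P \<subseteq> H}" by blast
  have card_M: "card M = N" unfolding H(2) N_def by (rule card_points_numeral(3)[OF H(1)])
  \<comment> \<open>Since \<open>M\<close> has N points, the chain card M \<le> card good \<le> N
    consists of equalities: every class has a common point, and \<open>t\<close> is
    injective.\<close>
  have "good = {..<N}"
    using card_subset_eq[OF _ good_N] M_good card_M card_good by simp
  moreover have "inj_on t good"
    using card_M M_good card_good by (intro eq_card_imp_inj_on[OF fin]) (simp add: M_def)
  ultimately have "bij_betw t {..<N} {P \<in> points. P \<subseteq> H}" "\<forall>i<N. \<forall>f\<in>F i. t i \<subseteq> fst f"
    using H(2) t unfolding M_def bij_betw_def by auto
  with H(1) show ?thesis unfolding N_def by blast
qed

text \<open>The flags whose line meets \<open>H\<close> just in the point \<open>t i\<close> cannot lie in another class.\<close>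
lemma class_point_unique:
  fixes F :: "nat \<Rightarrow> (('a ^ 5) set \<times> ('a ^ 5) set) set"
  assumes cover: "line_solid_flags \<subseteq> (\<Union>i<N. F i)" and H: "H \<in> solids"
    and bij: "bij_betw t {..<N} {P \<in> points. P \<subseteq> H}"
    and t: "\<forall>i<N. \<forall>f\<in>F i. t i \<subseteq> fst f"
    and i: "i < N" and Q: "Q \<in> points" "\<forall>f\<in>F i. Q \<subseteq> fst f"
  shows "Q = t i"
proof -
  have t_pt: "t j \<in> points" "t j \<subseteq> H" if "j < N" for j
    using bij_betwE[OF bij] that by simp_all
  \<comment> \<open>There are q^3 lines through \<open>t i\<close> outside \<open>H\<close>, hence
    at least two, and two different lines through \<open>t i\<close> share no other point.\<close>
  define S where "S = {L \<in> lines. t i \<subseteq> L} - {L \<in> lines. t i \<subseteq> L \<and> L \<subseteq> H}"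
  have "card S = (q ^ 3 + q ^ 2 + q + 1) - (q ^ 2 + q + 1)"
    unfolding S_def
    using card_lines_through_5[OF t_pt(1)[OF i]] card_lines_through(2)[OF t_pt[OF i] H]
    by (subst card_Diff_subset) auto
  then have "card S = q ^ 3" by simp
  moreover have "2 ^ 1 \<le> q ^ 3"
    using power_mono[OF q_ge_2, of 3] by simp
  ultimately have "\<not> card S \<le> Suc 0" by simp
  then obtain L L' where L: "L \<in> S" "L' \<in> S" "L \<noteq> L'"
    using card_le_Suc0_iff_eq[of S] by auto
  \<comment> \<open>A flag on \<open>K\<close> belongs to some class j, so \<open>t j\<close> is on
    \<open>K\<close>. As \<open>K\<close> meets \<open>H\<close> only in \<open>t i\<close> and
    \<open>t\<close> is injective, j = i, and \<open>Q\<close> lies on \<open>K\<close>.\<close>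
  have Q_sub: "Q \<subseteq> K" if K: "K \<in> S" for K
  proof -
    have K': "K \<in> lines" "t i \<subseteq> K" "\<not> K \<subseteq> H" using K by (auto simp: S_def)
    have "{H' \<in> solids. K \<subseteq> H'} \<noteq> {}"
      using card_solids_through_line_5[OF K'(1)] by (metis card.empty add_is_0 one_neq_zero)
    then obtain H' where H': "H' \<in> solids" "K \<subseteq> H'" by blast
    then have "(K, H') \<in> line_solid_flags" using K'(1) by (simp add: line_solid_flags_def)
    then obtain j where j: "j < N" "(K, H') \<in> F j" using cover by blast
    have tj: "t j \<subseteq> K" using t j by fastforce
    have "t j = t i"
    proof (rule ccontr)
      assume "t j \<noteq> t i"
      from line_subset[OF t_pt(1)[OF j(1)] t_pt(1)[OF i] this K'(1) tj K'(2) subspaces_of_dimD(1)[OF H]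
        t_pt(2)[OF j(1)] t_pt(2)[OF i]] K'(3)
      show False by simp
    qed
    then have "j = i"
      using inj_onD[OF bij_betw_imp_inj_on[OF bij]] j(1) i by simp
    with Q(2) j(2) show ?thesis by fastforce
  qed
  show ?thesis
  proof (rule ccontr)
    assume "Q \<noteq> t i"
    from lines_eqI[OF Q(1) t_pt(1)[OF i] this _ Q_sub[OF L(1)] _ _ Q_sub[OF L(2)]] L
    show False by (simp add: S_def)
  qed
qed

end

section \<open>Flags as sets of subspaces and as pairs of a line and a solid\<close>

lemma proper_subspace:
  fixes U :: "('a::field ^ 5) set"
  assumes U: "U \<in> subspaces_of_dim d" and d: "0 < d" "d < 5"
  shows "U \<noteq> {0}" "U \<noteq> UNIV"
proof -
  show "U \<noteq> {0}" using not_subset_zero[OF U d(1)] by blast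
  show "U \<noteq> UNIV" using subspaces_of_dim_mono[OF UNIV_dim_5 U] d(2) by auto
qed

text \<open>Comparable subspaces of equal dimension coincide, so a flag has exactly one member for
  each dimension in its type.\<close>

lemma flag_iff_line_solid:
  fixes F :: "('a::field ^ 5) set set"
  shows "F \<in> flags_of_type {2, 4} \<longleftrightarrow> (\<exists>f\<in>line_solid_flags. F = {fst f, snd f})"
proof
  assume "F \<in> flags_of_type {2, 4}"
  then have F: "flag F" "vec.dim ` F = {2, 4}" by (simp_all add: flags_of_type_def flag_type_def)
  have "2 \<in> vec.dim ` F" "4 \<in> vec.dim ` F" using F(2) by simp_all
  then obtain L H where L: "L \<in> F" "vec.dim L = 2" and H: "H \<in> F" "vec.dim H = 4"
    by (metis imageE)
  have sub: "vec.subspace U" if "U \<in> F" for U using F(1) that unfolding flag_def by blast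
  have chain: "U \<subseteq> W \<or> W \<subseteq> U" if "U \<in> F" "W \<in> F" for U W
    using F(1) that unfolding flag_def by blast
  have eq: "U = W" if "U \<in> F" "W \<in> F" "vec.dim U = vec.dim W" for U W
    using chain[OF that(1,2)] subspaces_of_dim_eqI[OF subspaces_of_dimI[OF sub refl] subspaces_of_dimI[OF sub]]
      that by metis
  have "L \<subseteq> H"
    using chain[OF L(1) H(1)] vec.dim_subset[of H L] L(2) H(2) by auto
  then have "(L, H) \<in> line_solid_flags"
    using L H sub by (simp add: line_solid_flags_def subspaces_of_dim_def)
  moreover have "F = {L, H}"
  proof (intro equalityI subsetI)
    fix U assume U: "U \<in> F"
    then have "vec.dim U \<in> {2, 4}" using F(2) by blast
    then show "U \<in> {L, H}" using eq[OF U L(1)] eq[OF U H(1)] L(2) H(2) by auto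
  qed (use L H in auto)
  ultimately show "\<exists>f\<in>line_solid_flags. F = {fst f, snd f}"
    by (intro bexI[of _ "(L, H)"]) simp_all
next
  assume "\<exists>f\<in>line_solid_flags. F = {fst f, snd f}"
  then obtain f where f: "f \<in> line_solid_flags" and F: "F = {fst f, snd f}" ..
  note fD = line_solid_flagsD[OF f]
  have d: "vec.dim (fst f) = 2" "vec.dim (snd f) = 4"
    by (rule subspaces_of_dimD(2)[OF fD(1)], rule subspaces_of_dimD(2)[OF fD(2)])
  have "fst f \<noteq> {0}" "fst f \<noteq> UNIV" "snd f \<noteq> {0}" "snd f \<noteq> UNIV"
    using proper_subspace[OF fD(1)] proper_subspace[OF fD(2)] by simp_all
  then show "F \<in> flags_of_type {2, 4}"
    unfolding F flags_of_type_def flag_type_def flag_def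
    using d fD subspaces_of_dimD(1)[OF fD(1)] subspaces_of_dimD(1)[OF fD(2)] by simp
qed

lemma point_pencil_iff:
  fixes T :: "('a::field ^ 5) set"
  assumes f: "f \<in> line_solid_flags" and T: "T \<in> points"
  shows "{fst f, snd f} \<in> point_pencil T \<longleftrightarrow> T \<subseteq> fst f"
proof -
  have F: "{fst f, snd f} \<in> flags_of_type {2, 4}" using f flag_iff_line_solid by blast
  note fD = line_solid_flagsD[OF f]
  note T' = proper_subspace[OF T] and spT = subspaces_of_dimD(1)[OF T]
  have fl: "flag {fst f, snd f}" using F by (simp add: flags_of_type_def)
  show ?thesis
  proof
    assume "{fst f, snd f} \<in> point_pencil T"
    then have "flag ({fst f, snd f} \<union> {T})" by (simp add: point_pencil_def)
    then have "T \<subseteq> fst f \<or> fst f \<subseteq> T" unfolding flag_def by blast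
    then show "T \<subseteq> fst f" using subspaces_of_dim_mono[OF fD(1) T] by auto
  next
    assume Tf: "T \<subseteq> fst f"
    have "flag ({fst f, snd f} \<union> {T})"
      using fl Tf subset_trans[OF Tf fD(3)] spT T' unfolding flag_def by simp
    with F show "{fst f, snd f} \<in> point_pencil T" by (simp add: point_pencil_def)
  qed
qed

lemma set_plus_ne_UNIV:
  fixes U :: "('a::field ^ 5) set"
  assumes "U \<in> subspaces_of_dim d" "W \<in> subspaces_of_dim e" "d + e < 5"
  shows "U + W \<noteq> UNIV"
proof
  assume eq: "U + W = UNIV"
  have "U + W \<subseteq> join U W"
    unfolding set_plus_def join_eq_sums[OF subspaces_of_dimD(1)[OF assms(1)] subspaces_of_dimD(1)[OF assms(2)]]
    by blast
  with eq have "UNIV \<subseteq> join U W" by simp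
  then have "join U W = UNIV" by (rule top.extremum_uniqueI)
  then have "vec.dim (join U W) = 5" by (simp only: subspaces_of_dimD(2)[OF UNIV_dim_5])
  then show False
    using dim_join[OF subspaces_of_dimD(1)[OF assms(1)] subspaces_of_dimD(1)[OF assms(2)]]
      subspaces_of_dimD(2)[OF assms(1)] subspaces_of_dimD(2)[OF assms(2)] assms(3) by linarith
qed

lemma set_plus_eq_UNIV:
  fixes U :: "('a::field ^ 5) set"
  assumes "vec.subspace U" "H \<in> solids" "\<not> U \<subseteq> H"
  shows "U + H = UNIV"
proof -
  obtain u where u: "u \<in> U" "u \<notin> H" using assms(3) by blast
  have "vec.span (insert u H) \<in> subspaces_of_dim (Suc 4)"
    by (rule span_insert_in_subspaces_of_dim[OF assms(2) u(2)])
  then have "vec.span (insert u H) \<in> subspaces_of_dim 5" by simp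
  then have "vec.span (insert u H) = UNIV"
    by (rule subspaces_of_dim_eqI[OF _ UNIV_dim_5]) simp
  moreover have "vec.span (insert u H) \<subseteq> join U H"
    unfolding join_def using u(1) by (intro vec.span_mono) blast
  ultimately have "join U H = UNIV" by blast
  then show ?thesis
    unfolding join_eq_sums[OF assms(1) subspaces_of_dimD(1)[OF assms(2)]] set_plus_def by blast
qed

lemma general_positionI:
  fixes f :: "('a::field ^ 5) set \<times> ('a ^ 5) set"
  assumes f: "f \<in> line_solid_flags" and g: "g \<in> line_solid_flags"
    and disj: "fst f \<inter> fst g = {0}" and fg: "\<not> fst f \<subseteq> snd g" and gf: "\<not> fst g \<subseteq> snd f"
  shows "general_position {fst f, snd f} {fst g, snd g}"
proof -
  note fD = line_solid_flagsD[OF f] and gD = line_solid_flagsD[OF g]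
  note sp = subspaces_of_dimD(1)
  have "fst f + snd g = UNIV" by (rule set_plus_eq_UNIV[OF sp[OF fD(1)] gD(2) fg])
  moreover have "snd f + fst g = UNIV"
    using set_plus_eq_UNIV[OF sp[OF gD(1)] fD(2) gf] by (simp add: add.commute)
  \<comment> \<open>The condition on the two solids follows from that on \<open>fst f\<close> and
    \<open>snd g\<close>, because \<open>fst f\<close> lies in \<open>snd f\<close>.\<close>
  moreover have "\<not> snd f \<subseteq> snd g" using fg subset_trans[OF fD(3)] by blast
  then have "snd f + snd g = UNIV" by (rule set_plus_eq_UNIV[OF sp[OF fD(2)] gD(2)])
  ultimately show ?thesis unfolding general_position_def using disj by simp
qed

lemma not_general_position_if_common_point:
  fixes f :: "('a::field ^ 5) set \<times> ('a ^ 5) set"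
  assumes f: "f \<in> line_solid_flags" and g: "g \<in> line_solid_flags"
    and P: "P \<in> points" "P \<subseteq> fst f" "P \<subseteq> fst g"
  shows "\<not> general_position {fst f, snd f} {fst g, snd g}"
  using Int_nonzero[OF P] set_plus_ne_UNIV[OF line_solid_flagsD(1)[OF f] line_solid_flagsD(1)[OF g]]
  unfolding general_position_def by simp

section \<open>Coloring by point-pencils, and the structure of colorings with q^3 + q^2 + q + 1
  colors\<close>

context gf_space
begin

text \<open>Every line meets a fixed solid \<open>H\<close>, so a flag can be colored by a point of
  its line in \<open>H\<close>. Flags of the same color have a common point on their lines and are
  not in general position.\<close>

lemma pencil_coloring_exists:
  "\<exists>c. proper_coloring (flags_of_type {2, 4} :: ('a ^ 5) set set set) general_position
    (q ^ 3 + q ^ 2 + q + 1) c"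
proof -
  obtain L :: "('a ^ 5) set" where L: "L \<in> lines"
  proof -
    obtain P :: "('a ^ 5) set" where P: "P \<in> points"
      by (rule exists_between[OF zero_in_subspaces_of_dim UNIV_dim_5]) simp_all
    show thesis
      by (rule exists_between[OF P UNIV_dim_5]) (simp_all add: that numeral_2_eq_2)
  qed
  have "{H \<in> solids. L \<subseteq> H} \<noteq> {}"
    using card_solids_through_line_5[OF L] by (metis card.empty add_is_0 one_neq_zero)
  then obtain H :: "('a ^ 5) set" where H: "H \<in> solids" by blast
  define N where "N = q ^ 3 + q ^ 2 + q + 1"
  have "finite {P \<in> points. P \<subseteq> H}" by simp
  then obtain e where "bij_betw e {P \<in> points. P \<subseteq> H} {0..<card {P \<in> points. P \<subseteq> H}}"
    using ex_bij_betw_finite_nat by blast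
  then have e: "bij_betw e {P \<in> points. P \<subseteq> H} {..<N}"
    unfolding card_points_numeral(3)[OF H] N_def atLeast0LessThan .
  \<comment> \<open>The coloring acts on flags as sets, so the point is chosen through
    \<open>point_pencil\<close> and not through the line component of a pair.\<close>
  define p where "p F = (SOME P. P \<in> points \<and> P \<subseteq> H \<and> F \<in> point_pencil P)" for F
  have p: "p {fst f, snd f} \<in> points" "p {fst f, snd f} \<subseteq> H" "p {fst f, snd f} \<subseteq> fst f"
    if f: "f \<in> line_solid_flags" for f
  proof -
    note fD = line_solid_flagsD[OF f]
    obtain P where "P \<in> points" "P \<subseteq> fst f" "P \<subseteq> H"
      by (rule common_point[OF fD(1) H line_meets_solid[OF fD(1) H]])
    then have "P \<in> points \<and> P \<subseteq> H \<and> {fst f, snd f} \<in> point_pencil P"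
      using point_pencil_iff[OF f] by simp
    then have *: "p {fst f, snd f} \<in> points \<and> p {fst f, snd f} \<subseteq> H
        \<and> {fst f, snd f} \<in> point_pencil (p {fst f, snd f})"
      unfolding p_def by (rule someI)
    then show "p {fst f, snd f} \<in> points" "p {fst f, snd f} \<subseteq> H" by simp_all
    then show "p {fst f, snd f} \<subseteq> fst f" using * point_pencil_iff[OF f] by simp
  qed
  have "proper_coloring (flags_of_type {2, 4}) general_position N (\<lambda>F. e (p F))"
    unfolding proper_coloring_def
  proof (intro conjI ballI impI)
    show "(\<lambda>F. e (p F)) \<in> flags_of_type {2, 4} \<rightarrow> {..<N}"
    proof
      fix F :: "('a ^ 5) set set" assume "F \<in> flags_of_type {2, 4}"
      then obtain f where "f \<in> line_solid_flags" "F = {fst f, snd f}"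
        using flag_iff_line_solid by blast
      then have "p F \<in> {P \<in> points. P \<subseteq> H}" using p by simp
      then show "e (p F) \<in> {..<N}" using bij_betwE[OF e] by blast
    qed
  next
    fix F G :: "('a ^ 5) set set"
    assume "F \<in> flags_of_type {2, 4}" "G \<in> flags_of_type {2, 4}" and gp: "general_position F G"
    then obtain f g where f: "f \<in> line_solid_flags" "F = {fst f, snd f}"
      and g: "g \<in> line_solid_flags" "G = {fst g, snd g}"
      using flag_iff_line_solid by metis
    show "e (p F) \<noteq> e (p G)"
    proof
      assume "e (p F) = e (p G)"
      then have "p F = p G"
        using inj_onD[OF bij_betw_imp_inj_on[OF e], of "p F" "p G"] p[OF f(1)] p[OF g(1)]
        unfolding f(2) g(2) by simp
      then have "p F \<subseteq> fst g" using p(3)[OF g(1)] g(2) by simp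
      then show False
        using not_general_position_if_common_point[OF f(1) g(1) p(1)[OF f(1)] p(3)[OF f(1)]] gp f(2) g(2)
        by simp
    qed
  qed
  then show ?thesis unfolding N_def by blast
qed

text \<open>The color classes, written as sets of pairs, are cocliques covering all flags, so
  \<open>coclique_cover\<close> supplies \<open>H\<close> and \<open>t\<close>. That no other point
  serves as base point is \<open>class_point_unique\<close>.\<close>

lemma proper_coloring_solid:
  fixes c :: "('a ^ 5) set set \<Rightarrow> nat"
  assumes q: "3 \<le> q" and N: "N = q ^ 3 + q ^ 2 + q + 1"
    and c: "proper_coloring (flags_of_type {2, 4}) general_position N c"
  shows "\<exists>H\<in>solids. \<exists>t. bij_betw t {..<N} {P \<in> points. P \<subseteq> H} \<and>
    (\<forall>i<N. \<forall>T\<in>points. color_class (flags_of_type {2, 4}) c i \<subseteq> point_pencil T \<longleftrightarrow> T = t i)"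
proof -
  define F where "F i = {f \<in> line_solid_flags. c {fst f, snd f} = i}" for i
  have fl: "{fst f, snd f} \<in> flags_of_type {2, 4}" if "f \<in> line_solid_flags" for f :: "('a ^ 5) set \<times> ('a ^ 5) set"
    using that flag_iff_line_solid by blast
  have class_iff: "color_class (flags_of_type {2, 4}) c i \<subseteq> point_pencil T \<longleftrightarrow> (\<forall>f\<in>F i. T \<subseteq> fst f)"
    if T: "T \<in> points" for T i
  proof
    assume sub: "color_class (flags_of_type {2, 4}) c i \<subseteq> point_pencil T"
    show "\<forall>f\<in>F i. T \<subseteq> fst f"
    proof
      fix f assume "f \<in> F i"
      then have f: "f \<in> line_solid_flags" "c {fst f, snd f} = i" by (simp_all add: F_def)
      then have "{fst f, snd f} \<in> color_class (flags_of_type {2, 4}) c i"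
        using fl by (simp add: color_class_def)
      from subsetD[OF sub this] show "T \<subseteq> fst f" using point_pencil_iff[OF f(1) T] by simp
    qed
  next
    assume *: "\<forall>f\<in>F i. T \<subseteq> fst f"
    show "color_class (flags_of_type {2, 4}) c i \<subseteq> point_pencil T"
    proof
      fix K assume K: "K \<in> color_class (flags_of_type {2, 4}) c i"
      then have "K \<in> flags_of_type {2, 4}" by (simp add: color_class_def)
      then obtain f where f: "f \<in> line_solid_flags" "K = {fst f, snd f}"
        using flag_iff_line_solid by blast
      then have "f \<in> F i" using K by (simp add: F_def color_class_def)
      then show "K \<in> point_pencil T" using * point_pencil_iff[OF f(1) T] f(2) by simp
    qed
  qed
  have cocl: "coclique (F i)" for i
    unfolding coclique_def
  proof (intro conjI ballI)
    show "F i \<subseteq> line_solid_flags" unfolding F_def by blast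
    fix f g assume f: "f \<in> F i" and g: "g \<in> F i"
    show "fst f \<inter> fst g \<noteq> {0} \<or> fst f \<subseteq> snd g \<or> fst g \<subseteq> snd f"
    proof (rule ccontr)
      assume neg: "\<not> (fst f \<inter> fst g \<noteq> {0} \<or> fst f \<subseteq> snd g \<or> fst g \<subseteq> snd f)"
      have f': "f \<in> line_solid_flags" "c {fst f, snd f} = i" using f by (simp_all add: F_def)
      have g': "g \<in> line_solid_flags" "c {fst g, snd g} = i" using g by (simp_all add: F_def)
      have "general_position {fst f, snd f} {fst g, snd g}"
        using neg by (intro general_positionI[OF f'(1) g'(1)]) simp_all
      then have "c {fst f, snd f} \<noteq> c {fst g, snd g}"
        using c fl[OF f'(1)] fl[OF g'(1)] unfolding proper_coloring_def by blast
      with f'(2) g'(2) show False by simp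
    qed
  qed
  have cover: "line_solid_flags \<subseteq> (\<Union>i<N. F i)"
  proof
    fix f :: "('a ^ 5) set \<times> ('a ^ 5) set" assume f: "f \<in> line_solid_flags"
    then have "c {fst f, snd f} < N" using c fl[OF f] unfolding proper_coloring_def by auto
    with f show "f \<in> (\<Union>i<N. F i)" unfolding F_def by simp
  qed
  obtain H t where H: "H \<in> solids" and bij: "bij_betw t {..<N} {P \<in> points. P \<subseteq> H}"
    and t: "\<forall>i<N. \<forall>f\<in>F i. t i \<subseteq> fst f"
    using coclique_cover[of F, OF q cocl] cover unfolding N by blast
  have "color_class (flags_of_type {2, 4}) c i \<subseteq> point_pencil T \<longleftrightarrow> T = t i"
    if i: "i < N" and T: "T \<in> points" for i T
  proof -
    have "(\<forall>f\<in>F i. T \<subseteq> fst f) \<longleftrightarrow> T = t i"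
      using class_point_unique[OF cover H bij t i T] t i by blast
    then show ?thesis unfolding class_iff[OF T] .
  qed
  with H bij show ?thesis by blast
qed

end

theorem theorem1p2:
  fixes q :: nat
    and Fl :: "('a::{field,finite} ^ 5) set set set"
  assumes "q = CARD('a)" and "q \<ge> 3"
    and "Fl = flags_of_type {2, 4}"
  shows "real (chromatic_number Fl general_position) = (real q ^ 4 - 1) / (real q - 1) \<and>
    chromatic_number Fl general_position = q ^ 3 + q ^ 2 + q + 1 \<and>
    (\<forall>c. proper_coloring Fl general_position (q ^ 3 + q ^ 2 + q + 1) c \<longrightarrow>
       (\<forall>i < q ^ 3 + q ^ 2 + q + 1.
          \<exists>!P. P \<in> point_pencil ` subspaces_of_dim 1 \<and> color_class Fl c i \<subseteq> P) \<and>
       (\<exists>H \<in> subspaces_of_dim 4.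
          {T \<in> subspaces_of_dim 1.
             \<exists>i < q ^ 3 + q ^ 2 + q + 1. color_class Fl c i \<subseteq> point_pencil T}
          = {T \<in> subspaces_of_dim 1. T \<subseteq> H}))"
proof -
  interpret gf_space q "TYPE('a)" by unfold_locales (rule assms(1))
  define N where "N = q ^ 3 + q ^ 2 + q + 1"
  have main_structure: "\<exists>H\<in>solids. \<exists>t. bij_betw t {..<N} {P \<in> points. P \<subseteq> H} \<and>
      (\<forall>i<N. \<forall>T\<in>points. color_class Fl c i \<subseteq> point_pencil T \<longleftrightarrow> T = t i)"
    if "proper_coloring Fl general_position N c" for c
    using proper_coloring_solid[OF assms(2) N_def] that unfolding assms(3) .
  have moreover_part: "(\<forall>i < N. \<exists>!P. P \<in> point_pencil ` points \<and> color_class Fl c i \<subseteq> P) \<and>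
      (\<exists>H \<in> solids. {T \<in> points. \<exists>i < N. color_class Fl c i \<subseteq> point_pencil T}
        = {T \<in> points. T \<subseteq> H})"
    if col: "proper_coloring Fl general_position N c" for c
  proof -
    obtain H t where H: "H \<in> solids" and bij: "bij_betw t {..<N} {P \<in> points. P \<subseteq> H}"
      and t: "\<forall>i<N. \<forall>T\<in>points. color_class Fl c i \<subseteq> point_pencil T \<longleftrightarrow> T = t i"
      using main_structure[OF col] by (elim bexE exE conjE)
    have t_iff: "color_class Fl c i \<subseteq> point_pencil T \<longleftrightarrow> T = t i" if "i < N" "T \<in> points" for i T
      using t that by simp
    have img: "t ` {..<N} = {P \<in> points. P \<subseteq> H}" using bij by (simp add: bij_betw_def)
    have t_pt: "t i \<in> points" if "i < N" for i using bij_betwE[OF bij] that by simp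
    have "\<exists>!P. P \<in> point_pencil ` points \<and> color_class Fl c i \<subseteq> P" if i: "i < N" for i
    proof (rule ex1I)
      show "point_pencil (t i) \<in> point_pencil ` points \<and> color_class Fl c i \<subseteq> point_pencil (t i)"
        using t_iff[OF i t_pt[OF i]] t_pt[OF i] by simp
      fix P assume P: "P \<in> point_pencil ` points \<and> color_class Fl c i \<subseteq> P"
      then obtain T where T: "P = point_pencil T" "T \<in> points" by (elim conjE imageE)
      then show "P = point_pencil (t i)" using t_iff[OF i T(2)] P by simp
    qed
    moreover have "{T \<in> points. \<exists>i < N. color_class Fl c i \<subseteq> point_pencil T} = t ` {..<N}"
    proof (intro equalityI subsetI)
      fix T assume "T \<in> {T \<in> points. \<exists>i < N. color_class Fl c i \<subseteq> point_pencil T}"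
      then obtain i where i: "T \<in> points" "i < N" "color_class Fl c i \<subseteq> point_pencil T"
        by (elim CollectE conjE exE)
      then have "T = t i" using t_iff[OF i(2,1)] by simp
      with i(2) show "T \<in> t ` {..<N}" by simp
    next
      fix T assume "T \<in> t ` {..<N}"
      then obtain i where i: "T = t i" "i < N" by (elim imageE) simp
      then have "color_class Fl c i \<subseteq> point_pencil T" using t_iff[OF i(2) t_pt[OF i(2)]] by simp
      with i t_pt[OF i(2)] show "T \<in> {T \<in> points. \<exists>i < N. color_class Fl c i \<subseteq> point_pencil T}"
        by (intro CollectI conjI exI[of _ i]) simp_all
    qed
    then have "\<exists>H \<in> solids. {T \<in> points. \<exists>i < N. color_class Fl c i \<subseteq> point_pencil T}
        = {T \<in> points. T \<subseteq> H}"
      unfolding img using H by (rule bexI)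
    ultimately show ?thesis by simp
  qed
  have chrom: "chromatic_number Fl general_position = N"
    unfolding chromatic_number_def
  proof (rule Least_equality)
    show "\<exists>c. proper_coloring Fl general_position N c"
      using pencil_coloring_exists unfolding assms(3) N_def .
    fix k assume "\<exists>c. proper_coloring Fl general_position k c"
    then obtain c where c: "proper_coloring Fl general_position k c" ..
    show "N \<le> k"
    proof (rule ccontr)
      assume k: "\<not> N \<le> k"
      then have "{..<k} \<subseteq> {..<N}" by simp
      with c have cN: "proper_coloring Fl general_position N c"
        unfolding proper_coloring_def by (meson Pi_mono subsetD)
      \<comment> \<open>A coloring with k < N colors is also one with N colors, and its class k is
        empty. The empty class lies in every point-pencil, so every point would be a base point and
        would lie in the solid \<open>H\<close>.\<close>
      have empty: "color_class Fl c k = {}"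
        using c unfolding proper_coloring_def color_class_def by auto
      obtain H where H: "H \<in> solids"
        "{T \<in> points. \<exists>i < N. color_class Fl c i \<subseteq> point_pencil T} = {T \<in> points. T \<subseteq> H}"
        using moreover_part[OF cN] by (elim conjE bexE)
      have "T \<in> {T \<in> points. \<exists>i < N. color_class Fl c i \<subseteq> point_pencil T}" if "T \<in> points" for T
        using that k empty by (intro CollectI conjI exI[of _ k]) simp_all
      then have all: "T \<subseteq> H" if "T \<in> points" for T using that unfolding H(2) by simp
      have "UNIV \<subseteq> H"
      proof
        fix v :: "'a ^ 5"
        show "v \<in> H"
        proof (cases "v = 0")
          case True
          then show ?thesis using vec.subspace_0[OF subspaces_of_dimD(1)[OF H(1)]] by simp
        next
          case False
          then have "vec.span {v} \<in> points"
            by (intro subspaces_of_dimI) (simp_all add: vec.dim_singleton)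
          from all[OF this] vec.span_base[of v "{v}"] show ?thesis by blast
        qed
      qed
      from subspaces_of_dim_mono[OF UNIV_dim_5 H(1) this] show False by simp
    qed
  qed
  moreover have "real N = (real q ^ 4 - 1) / (real q - 1)"
  proof -
    have "real N * (real q - 1) = real q ^ 4 - 1"
      by (simp add: N_def algebra_simps eval_nat_numeral)
    then show ?thesis using assms(2) by (simp add: field_simps)
  qed
  ultimately show ?thesis using moreover_part unfolding N_def by simp
qed

end
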